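(* Let $H$ be a semisimple Hopf algebra over an algebraically closed field $k$ of characteristic $0$. Then for all integers $m,n\ge 0$, $$z_{2m+1}=z_{2m},\qquad z_n=z_2^{\frac{n-(n\bmod 2)}{2}}\in Z(H),$$ where $z_n\in H$ are the elements built from the idempotent integral of $H$ (defined in the context).
   Context: $H$ is finite dimensional with comultiplication $\Delta(h)=\sum h_1\otimes h_2$ (Sweedler notation), counit $\varepsilon$, antipode $S$ and center $Z(H)$. $\Lambda$ denotes the idempotent integral of $H$: $h\Lambda=\varepsilon(h)\Lambda=\Lambda h$ for all $h\in H$ and $\varepsilon(\Lambda)=1$. Let $\Lambda^1,\Lambda^2,\dots$ be copies of $\Lambda$ and write $\Delta(\Lambda^i)=\sum\Lambda^i_1\otimes\Lambda^i_2$. Set $z_0=1$ and, for $n\ge1$, $$z_n=\sum\Lambda^1_1\Lambda^2_1\cdots\Lambda^n_1\,S(\Lambda^1_2)S(\Lambda^2_2)\cdots S(\Lambda^n_2).$$ Here $n\bmod 2\in\{0,1\}$. *)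

theory Defs
  imports
    "HOL-Library.Poly_Mapping"
    "HOL-Computational_Algebra.Polynomial"
begin

section \<open>Formal linear combinations\<close>

text \<open>
  The free \<open>k\<close>-vector space on a type \<open>'i\<close> is \<open>'i \<Rightarrow>\<^sub>0 'k\<close>; \<open>form_scale\<close> is its scalar
  multiplication, \<open>Poly_Mapping.single i 1\<close> its basis vector at \<open>i\<close>, and \<open>lin_extend scl f\<close> the
  linear map into the space with scalar multiplication \<open>scl\<close> which sends the basis vector at
  \<open>i\<close> to \<open>f i\<close>.
\<close>

definition form_scale :: "'k::field \<Rightarrow> ('i \<Rightarrow>\<^sub>0 'k) \<Rightarrow> ('i \<Rightarrow>\<^sub>0 'k)" where
  "form_scale c p = Poly_Mapping.map ((*) c) p"

definition lin_extend ::
    "('k::field \<Rightarrow> 'v::ab_group_add \<Rightarrow> 'v) \<Rightarrow> ('i \<Rightarrow> 'v) \<Rightarrow> ('i \<Rightarrow>\<^sub>0 'k) \<Rightarrow> 'v" where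
  "lin_extend scl f p = (\<Sum>i\<in>Poly_Mapping.keys p. scl (Poly_Mapping.lookup p i) (f i))"

lemma lookup_form_scale [simp]:
  "Poly_Mapping.lookup (form_scale c p) i = c * Poly_Mapping.lookup p i"
  unfolding form_scale_def by (simp add: Poly_Mapping.map.rep_eq when_def)

lemma vector_space_form_scale: "vector_space (form_scale :: 'k::field \<Rightarrow> ('i \<Rightarrow>\<^sub>0 'k) \<Rightarrow> _)"
  by unfold_locales (auto intro!: poly_mapping_eqI simp: lookup_add algebra_simps)

lemma lin_extend_superset:
  assumes "vector_space scl" "finite A" "Poly_Mapping.keys p \<subseteq> A"
  shows "lin_extend scl f p = (\<Sum>i\<in>A. scl (Poly_Mapping.lookup p i) (f i))"
proof -
  interpret vector_space scl by fact
  show ?thesis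
    unfolding lin_extend_def
    by (rule sum.mono_neutral_left) (use assms in \<open>auto simp: in_keys_iff\<close>)
qed

lemma linear_lin_extend:
  assumes "vector_space scl"
  shows "Vector_Spaces.linear form_scale scl (lin_extend scl f)"
proof -
  interpret T: vector_space scl by fact
  interpret F: vector_space "form_scale :: 'a \<Rightarrow> ('c \<Rightarrow>\<^sub>0 'a) \<Rightarrow> _"
    by (rule vector_space_form_scale)
  show ?thesis
  proof unfold_locales
    fix p q :: "'c \<Rightarrow>\<^sub>0 'a"
    let ?A = "Poly_Mapping.keys p \<union> Poly_Mapping.keys q"
    have "Poly_Mapping.keys (p + q) \<subseteq> ?A" by (rule keys_add)
    then show "lin_extend scl f (p + q) = lin_extend scl f p + lin_extend scl f q"
      by (simp add: lin_extend_superset[OF assms, of ?A] lookup_add T.scale_left_distrib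
          sum.distrib)
  next
    fix c and p :: "'c \<Rightarrow>\<^sub>0 'a"
    have "Poly_Mapping.keys (form_scale c p) \<subseteq> Poly_Mapping.keys p"
      by (auto simp: in_keys_iff)
    then show "lin_extend scl f (form_scale c p) = scl c (lin_extend scl f p)"
      by (simp add: lin_extend_superset[OF assms, of "Poly_Mapping.keys p"] T.scale_sum_right)
  qed
qed

lemma lin_extend_single [simp]:
  "vector_space scl \<Longrightarrow> lin_extend scl f (Poly_Mapping.single i c) = scl c (f i)"
  by (subst lin_extend_superset[of _ "{i}"]) auto


section \<open>Tensor powers of a vector space\<close>

text \<open>
  \<open>H \<otimes> H\<close> and \<open>H \<otimes> H \<otimes> H\<close> are the free vector spaces on pairs and triples modulo the
  multilinearity relations, i.e. their elements are the cosets \<open>tensor2 scale p\<close> and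
  \<open>tensor3 scale p\<close>. \<open>linearity_relations scale \<iota>\<close> are the relations which make \<open>\<iota>\<close> linear;
  they are imposed on every tensor slot.
\<close>

definition linearity_relations ::
    "('k::field \<Rightarrow> 'h::ab_group_add \<Rightarrow> 'h) \<Rightarrow> ('h \<Rightarrow> ('i \<Rightarrow>\<^sub>0 'k)) \<Rightarrow> ('i \<Rightarrow>\<^sub>0 'k) set" where
  "linearity_relations scale \<iota> =
     {\<iota> (x + y) - \<iota> x - \<iota> y | x y. True} \<union> {\<iota> (scale c x) - form_scale c (\<iota> x) | c x. True}"

definition pure2 :: "'h \<Rightarrow> 'h \<Rightarrow> ('h \<times> 'h \<Rightarrow>\<^sub>0 'k::field)" where
  "pure2 x y = Poly_Mapping.single (x, y) 1"

definition pure3 :: "'h \<Rightarrow> 'h \<Rightarrow> 'h \<Rightarrow> ('h \<times> 'h \<times> 'h \<Rightarrow>\<^sub>0 'k::field)" where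
  "pure3 x y z = Poly_Mapping.single (x, y, z) 1"

definition tensor2_null ::
    "('k::field \<Rightarrow> 'h::ab_group_add \<Rightarrow> 'h) \<Rightarrow> ('h \<times> 'h \<Rightarrow>\<^sub>0 'k) set" where
  "tensor2_null scale = module.span form_scale
     ((\<Union>y. linearity_relations scale (\<lambda>x. pure2 x y)) \<union>
      (\<Union>x. linearity_relations scale (\<lambda>y. pure2 x y)))"

definition tensor3_null ::
    "('k::field \<Rightarrow> 'h::ab_group_add \<Rightarrow> 'h) \<Rightarrow> ('h \<times> 'h \<times> 'h \<Rightarrow>\<^sub>0 'k) set" where
  "tensor3_null scale = module.span form_scale
     ((\<Union>y z. linearity_relations scale (\<lambda>x. pure3 x y z)) \<union>
      (\<Union>x z. linearity_relations scale (\<lambda>y. pure3 x y z)) \<union>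
      (\<Union>x y. linearity_relations scale (\<lambda>z. pure3 x y z)))"

definition tensor2 ::
    "('k::field \<Rightarrow> 'h::ab_group_add \<Rightarrow> 'h) \<Rightarrow> ('h \<times> 'h \<Rightarrow>\<^sub>0 'k) \<Rightarrow> ('h \<times> 'h \<Rightarrow>\<^sub>0 'k) set" where
  "tensor2 scale p = {q. q - p \<in> tensor2_null scale}"

definition tensor3 ::
    "('k::field \<Rightarrow> 'h::ab_group_add \<Rightarrow> 'h) \<Rightarrow> ('h \<times> 'h \<times> 'h \<Rightarrow>\<^sub>0 'k)
      \<Rightarrow> ('h \<times> 'h \<times> 'h \<Rightarrow>\<^sub>0 'k) set" where
  "tensor3 scale p = {q. q - p \<in> tensor3_null scale}"

text \<open>
  For a tensor \<open>t = \<Sum> x \<otimes> y\<close>, \<open>sweedler scl f t\<close> is the sum \<open>\<Sum> f x y\<close>. It is computed from a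
  chosen representative of \<open>t\<close>; the choice is irrelevant for bilinear \<open>f\<close>, see \<open>sweedler_tensor2\<close>
  below.
\<close>

definition tensor_rep :: "('h \<times> 'h \<Rightarrow>\<^sub>0 'k::field) set \<Rightarrow> ('h \<times> 'h \<Rightarrow>\<^sub>0 'k)" where
  "tensor_rep t = (SOME p. p \<in> t)"

definition sweedler ::
    "('k::field \<Rightarrow> 'v::ab_group_add \<Rightarrow> 'v) \<Rightarrow> ('h \<Rightarrow> 'h \<Rightarrow> 'v) \<Rightarrow> ('h \<times> 'h \<Rightarrow>\<^sub>0 'k) set \<Rightarrow> 'v" where
  "sweedler scl f t = lin_extend scl (\<lambda>(x, y). f x y) (tensor_rep t)"

lemma lin_extend_tensor2_null:
  assumes scl: "vector_space scl"
    and l: "\<And>y. Vector_Spaces.linear scale scl (\<lambda>x. f x y)"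
    and r: "\<And>x. Vector_Spaces.linear scale scl (f x)"
    and p: "p \<in> tensor2_null scale"
  shows "lin_extend scl (\<lambda>(x, y). f x y) p = 0"
proof -
  interpret T: vector_space scl by fact
  interpret F: vector_space "form_scale :: 'a \<Rightarrow> ('c \<times> 'c \<Rightarrow>\<^sub>0 'a) \<Rightarrow> _"
    by (rule vector_space_form_scale)
  interpret E: Vector_Spaces.linear form_scale scl "lin_extend scl (\<lambda>(x, y). f x y)"
    by (rule linear_lin_extend[OF scl])
  have [simp]: "lin_extend scl (\<lambda>(x, y). f x y) (pure2 x y) = f x y" for x y
    by (simp add: pure2_def scl)
  have L [simp]: "f (a + b) y = f a y + f b y" "f (scale c a) y = scl c (f a y)" for a b c y
    using module_hom.add[OF Vector_Spaces.linear.axioms(3)[OF l[of y]]]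
      module_hom.scale[OF Vector_Spaces.linear.axioms(3)[OF l[of y]]] by auto
  have R [simp]: "f x (a + b) = f x a + f x b" "f x (scale c a) = scl c (f x a)" for a b c x
    using module_hom.add[OF Vector_Spaces.linear.axioms(3)[OF r[of x]]]
      module_hom.scale[OF Vector_Spaces.linear.axioms(3)[OF r[of x]]] by auto
  show ?thesis
    using p unfolding tensor2_null_def
  proof (induction rule: F.span_induct_alt)
    case base
    show ?case by (rule E.zero)
  next
    case (step c x y)
    from step(1) have "lin_extend scl (\<lambda>(x, y). f x y) x = 0"
      by (auto simp: linearity_relations_def E.diff E.scale)
    with step show ?case by (simp add: E.add E.scale)
  qed
qed

lemma sweedler_tensor2:
  assumes scl: "vector_space scl"
    and l: "\<And>y. Vector_Spaces.linear scale scl (\<lambda>x. f x y)"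
    and r: "\<And>x. Vector_Spaces.linear scale scl (f x)"
  shows "sweedler scl f (tensor2 scale p) = lin_extend scl (\<lambda>(x, y). f x y) p"
proof -
  interpret F: vector_space "form_scale :: 'a \<Rightarrow> ('c \<times> 'c \<Rightarrow>\<^sub>0 'a) \<Rightarrow> _"
    by (rule vector_space_form_scale)
  interpret E: Vector_Spaces.linear form_scale scl "lin_extend scl (\<lambda>(x, y). f x y)"
    by (rule linear_lin_extend[OF scl])
  have "p \<in> tensor2 scale p"
    by (simp add: tensor2_def tensor2_null_def F.span_zero)
  then have "tensor_rep (tensor2 scale p) \<in> tensor2 scale p"
    unfolding tensor_rep_def by (rule someI)
  then have "tensor_rep (tensor2 scale p) - p \<in> tensor2_null scale"
    by (simp add: tensor2_def)
  from lin_extend_tensor2_null[OF scl l r this] show ?thesis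
    by (simp add: sweedler_def E.diff)
qed


section \<open>Hopf algebras\<close>

locale algebra_over = vector_space scale
  for scale :: "'k::field \<Rightarrow> 'h::ring_1 \<Rightarrow> 'h" +
  assumes scale_mult_left: "scale c x * y = scale c (x * y)"
    and scale_mult_right: "x * scale c y = scale c (x * y)"

locale coalgebra = vector_space scale
  for scale :: "'k::field \<Rightarrow> 'h::ab_group_add \<Rightarrow> 'h"
    and \<Delta> :: "'h \<Rightarrow> ('h \<times> 'h \<Rightarrow>\<^sub>0 'k) set"
    and \<epsilon> :: "'h \<Rightarrow> 'k" +
  assumes comult_tensor: "\<Delta> h \<in> range (tensor2 scale)"
    and comult_add: "\<lbrakk>p \<in> \<Delta> x; q \<in> \<Delta> y\<rbrakk> \<Longrightarrow> p + q \<in> \<Delta> (x + y)"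
    and comult_scale: "p \<in> \<Delta> x \<Longrightarrow> form_scale c p \<in> \<Delta> (scale c x)"
    and counit_linear: "Vector_Spaces.linear scale (*) \<epsilon>"
    and coassoc:
      "tensor3 scale
         (sweedler form_scale (\<lambda>a b. sweedler form_scale (\<lambda>c d. pure3 c d b) (\<Delta> a)) (\<Delta> h)) =
       tensor3 scale
         (sweedler form_scale (\<lambda>a b. sweedler form_scale (\<lambda>c d. pure3 a c d) (\<Delta> b)) (\<Delta> h))"
    and counit_left: "sweedler scale (\<lambda>a b. scale (\<epsilon> a) b) (\<Delta> h) = h"
    and counit_right: "sweedler scale (\<lambda>a b. scale (\<epsilon> b) a) (\<Delta> h) = h"

locale bialgebra = algebra_over scale + coalgebra scale \<Delta> \<epsilon>
  for scale :: "'k::field \<Rightarrow> 'h::ring_1 \<Rightarrow> 'h" and \<Delta> and \<epsilon> +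
  assumes comult_one: "\<Delta> 1 = tensor2 scale (pure2 1 1)"
    and comult_mult:
      "\<Delta> (x * y) = tensor2 scale
         (sweedler form_scale
           (\<lambda>a b. sweedler form_scale (\<lambda>c d. pure2 (a * c) (b * d)) (\<Delta> y)) (\<Delta> x))"
    and counit_one: "\<epsilon> 1 = 1"
    and counit_mult: "\<epsilon> (x * y) = \<epsilon> x * \<epsilon> y"

locale hopf_algebra = bialgebra scale \<Delta> \<epsilon>
  for scale :: "'k::field \<Rightarrow> 'h::ring_1 \<Rightarrow> 'h" and \<Delta> and \<epsilon> +
  fixes S :: "'h \<Rightarrow> 'h"
  assumes antipode_linear: "Vector_Spaces.linear scale scale S"
    and antipode_left: "sweedler scale (\<lambda>a b. S a * b) (\<Delta> h) = scale (\<epsilon> h) 1"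
    and antipode_right: "sweedler scale (\<lambda>a b. a * S b) (\<Delta> h) = scale (\<epsilon> h) 1"

definition left_ideal :: "'a::ring_1 set \<Rightarrow> bool" where
  "left_ideal I \<longleftrightarrow> 0 \<in> I \<and> (\<forall>x\<in>I. \<forall>y\<in>I. x + y \<in> I) \<and> (\<forall>a. \<forall>x\<in>I. a * x \<in> I)"

text \<open>A ring is semisimple if every submodule of its left regular module is a direct summand.\<close>

definition semisimple_ring :: "'a::ring_1 itself \<Rightarrow> bool" where
  "semisimple_ring TYPE('a) \<longleftrightarrow>
     (\<forall>I :: 'a set. left_ideal I \<longrightarrow>
        (\<exists>J. left_ideal J \<and> I \<inter> J = {0} \<and> {x + y | x y. x \<in> I \<and> y \<in> J} = UNIV))"

definition ring_center :: "'a::ring_1 set" where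
  "ring_center = {z. \<forall>x. z * x = x * z}"

definition idempotent_integral ::
    "('k::field \<Rightarrow> 'h::ring_1 \<Rightarrow> 'h) \<Rightarrow> ('h \<Rightarrow> 'k) \<Rightarrow> 'h \<Rightarrow> bool" where
  "idempotent_integral scale \<epsilon> \<Lambda> \<longleftrightarrow>
     (\<forall>h. h * \<Lambda> = scale (\<epsilon> h) \<Lambda> \<and> \<Lambda> * h = scale (\<epsilon> h) \<Lambda>) \<and> \<epsilon> \<Lambda> = 1"

text \<open>
  With \<open>p = \<Sum> c (x, y)\<close> a representative of \<open>\<Delta> \<Lambda>\<close>, the \<open>n\<close>-fold Sweedler sum over independent
  copies of \<open>\<Lambda>\<close> runs over the words \<open>w\<close> of length \<open>n\<close> in the terms \<open>(x, y)\<close> of \<open>p\<close>: the word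
  \<open>(x\<^sub>1, y\<^sub>1) \<dots> (x\<^sub>n, y\<^sub>n)\<close> contributes \<open>c\<^sub>1 \<dots> c\<^sub>n (x\<^sub>1 \<dots> x\<^sub>n) (S y\<^sub>1 \<dots> S y\<^sub>n)\<close>.
  The choice of \<open>p\<close> is irrelevant, as the summand is linear in every \<open>x\<^sub>i\<close> and every \<open>y\<^sub>i\<close>.
\<close>

definition hopf_z ::
    "('k::field \<Rightarrow> 'h::ring_1 \<Rightarrow> 'h) \<Rightarrow> ('h \<Rightarrow> ('h \<times> 'h \<Rightarrow>\<^sub>0 'k) set) \<Rightarrow> ('h \<Rightarrow> 'h) \<Rightarrow> 'h \<Rightarrow> nat \<Rightarrow> 'h"
  where
  "hopf_z scale \<Delta> S \<Lambda> n =
     (let p = tensor_rep (\<Delta> \<Lambda>) in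
      \<Sum>w | length w = n \<and> set w \<subseteq> Poly_Mapping.keys p.
        scale (prod_list (map (Poly_Mapping.lookup p) w))
          (prod_list (map fst w) * prod_list (map (\<lambda>t. S (snd t)) w)))"

lemma (in algebra_over) hopf_z_0: "hopf_z scale \<Delta> S \<Lambda> 0 = 1"
proof -
  have *: "{w. length w = 0 \<and> set w \<subseteq> A} = {[]}" for A :: "'x set" by auto
  show ?thesis unfolding hopf_z_def Let_def * by simp
qed

lemma (in algebra_over) hopf_z_1:
  "hopf_z scale \<Delta> S \<Lambda> (Suc 0) = sweedler scale (\<lambda>x y. x * S y) (\<Delta> \<Lambda>)"
proof -
  have *: "{w. length w = Suc 0 \<and> set w \<subseteq> A} = (\<lambda>t. [t]) ` A" for A :: "'x set"
    by (auto simp: length_Suc_conv)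
  show ?thesis
    unfolding hopf_z_def Let_def *
    by (simp add: sweedler_def lin_extend_def sum.reindex inj_on_def case_prod_beta)
qed

end

theory Submission
  imports Defs
begin

text \<open>
  Write \<open>\<Lambda>\<^sub>1 \<otimes> \<Lambda>\<^sub>2\<close> for the coproduct of \<open>\<Lambda>\<close> and \<open>e = \<Lambda>\<^sub>1 \<otimes> S \<Lambda>\<^sub>2\<close>. Invariance of the integral lets
  elements of the algebra pass from one leg of \<open>e\<close> to the other, but the result is twisted by
  \<open>S\<^sup>2\<close>. If \<open>S\<^sup>2 = id\<close>, then \<open>e\<close> is a symmetric Casimir element: its legs may be exchanged
  (\<open>casimir_flip\<close>) and \<open>x e = e x\<close> for the outer actions (\<open>casimir_outer\<close>). With two copies
  \<open>a \<otimes> b\<close> and \<open>c \<otimes> d\<close> of \<open>e\<close>, moving legs around in \<open>\<Sum> a c x b d\<close> brings \<open>x\<close> to the far right as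
  well as to the far left, so this sum equals both \<open>z\<^sub>2 x\<close> and \<open>x z\<^sub>2\<close> (\<open>casimir_double_right\<close>,
  \<open>casimir_double_left\<close>). Hence \<open>z\<^sub>2\<close> is central, and \<open>z\<^sub>n\<^sub>+\<^sub>2 = z\<^sub>2 z\<^sub>n\<close>. As \<open>z\<^sub>0 = z\<^sub>1 = 1\<close>, everything
  follows.

  The substance is therefore \<open>S\<^sup>2 = id\<close> (\<open>antipode_involutive\<close>), the theorem of Larson and
  Radford. Its proof is linear algebra on \<open>H\<close> and rests on the form
  \<open>lam h = Tr (x \<mapsto> h S\<^sup>2 x)\<close>.

  First, \<open>lam\<close> is a left integral of the dual algebra with \<open>lam \<Lambda> = 1\<close> and
  \<open>lam (h x) = lam (x S\<^sup>2 h)\<close>. Consequently \<open>lam\<close> is nondegenerate and \<open>S\<close> is bijective, and there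
  is a grouplike element \<open>G\<close> (\<open>modular\<close>) with \<open>lam h\<^sub>1 h\<^sub>2 = lam h G\<close>. The form \<open>lam (_ G)\<close> is a
  right integral, and comparing the twists of the two integrals yields \<open>h G = G S\<^sup>4 h\<close>. Grouplike
  elements are linearly independent, so \<open>G\<close>, and with it \<open>S\<^sup>2\<close>, has finite order.

  Second, \<open>lam 1 = Tr S\<^sup>2\<close> does not vanish (\<open>trace_S2_nonzero\<close>). An element \<open>w\<close> of \<open>H\<close> satisfies
  \<open>x w = w S\<^sup>2 x\<close>. Decompose \<open>1\<close> into orthogonal idempotents \<open>f\<close> that are primitive in the fixed ring
  of \<open>S\<^sup>2\<close>. Then \<open>w f = u\<^sub>f f\<close> for scalars \<open>u\<^sub>f\<close>, every corner \<open>f H g\<close> has dimension at most one, and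
  \<open>S\<^sup>2\<close> acts on it as \<open>u\<^sub>g / u\<^sub>f\<close>. So \<open>Tr S\<^sup>2\<close> is the sum of \<open>u\<^sub>g / u\<^sub>f\<close> over all pairs with
  \<open>f H g \<noteq> 0\<close>; over the complex numbers it would be a sum of squares \<open>|\<Sum> u\<^sub>f|\<^sup>2\<close> of sums of roots
  of unity, one of which is \<open>1\<close> because \<open>\<Lambda>\<close> is one of the idempotents and is linked only to
  itself. \<open>sum_root_of_unity_ratios_nonzero\<close> makes this positivity argument available over an
  arbitrary field of characteristic zero.

  Third, \<open>lam 1 \<noteq> 0\<close> forces \<open>G = 1\<close>, hence \<open>S\<^sup>4 = id\<close>, so that \<open>Tr S\<^sup>2\<close> is an integer of absolute
  value at most \<open>dim H\<close>. Convolution with the regular character, divided by \<open>dim H\<close>, is an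
  idempotent operator commuting with \<open>S\<^sup>2\<close>, and the trace of \<open>S\<^sup>2\<close> on its image is
  \<open>Tr S\<^sup>2 / dim H\<close>. That quotient is again an integer; it is nonzero, so it is \<open>\<plusminus>1\<close>, and \<open>S\<^sup>2\<close> is
  \<open>id\<close> or \<open>-id\<close>. Since \<open>S\<^sup>2\<close> fixes \<open>1\<close>, it is \<open>id\<close>.
\<close>

section \<open>Traces of linear operators\<close>

context finite_dimensional_vector_space
begin

definition linear_form :: "('b \<Rightarrow> 'a) \<Rightarrow> bool" where
  "linear_form f \<longleftrightarrow> (\<forall>x y. f (x + y) = f x + f y) \<and> (\<forall>c x. f (scale c x) = c * f x)"

definition linear_op :: "('b \<Rightarrow> 'b) \<Rightarrow> bool" where
  "linear_op f \<longleftrightarrow> (\<forall>x y. f (x + y) = f x + f y) \<and> (\<forall>c x. f (scale c x) = scale c (f x))"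

definition bilinear_form :: "('b \<Rightarrow> 'b \<Rightarrow> 'a) \<Rightarrow> bool" where
  "bilinear_form f \<longleftrightarrow> (\<forall>y. linear_form (\<lambda>x. f x y)) \<and> (\<forall>x. linear_form (f x))"

lemma linear_formI:
  "(\<And>x y. f (x + y) = f x + f y) \<Longrightarrow> (\<And>c x. f (scale c x) = c * f x) \<Longrightarrow> linear_form f"
  by (simp add: linear_form_def)

lemma linear_opI:
  "(\<And>x y. f (x + y) = f x + f y) \<Longrightarrow> (\<And>c x. f (scale c x) = scale c (f x)) \<Longrightarrow> linear_op f"
  by (simp add: linear_op_def)

lemma bilinear_formI:
  "(\<And>y. linear_form (\<lambda>x. f x y)) \<Longrightarrow> (\<And>x. linear_form (\<lambda>y. f x y)) \<Longrightarrow> bilinear_form f"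
  by (simp add: bilinear_form_def)

lemma bilinear_formD:
  assumes "bilinear_form f"
  shows "linear_form (\<lambda>x. f x y)" "linear_form (\<lambda>y. f x y)"
  using assms by (simp_all add: bilinear_form_def)

lemma linear_form_iff: "linear_form f \<longleftrightarrow> Vector_Spaces.linear scale (*) f"
proof -
  interpret K: vector_space "(*) :: 'a \<Rightarrow> 'a \<Rightarrow> 'a"
    by unfold_locales (auto simp: algebra_simps)
  show ?thesis
    unfolding linear_form_def linear_iff_module_hom module_hom_iff
    using module_axioms K.module_axioms by auto
qed

lemma linear_op_iff: "linear_op f \<longleftrightarrow> Vector_Spaces.linear scale scale f"
  unfolding linear_op_def linear_iff_module_hom module_hom_iff
  using module_axioms by auto

lemma linear_form_add: "linear_form f \<Longrightarrow> f (x + y) = f x + f y"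
  and linear_form_scale: "linear_form f \<Longrightarrow> f (scale c x) = c * f x"
  by (simp_all add: linear_form_def)

lemma linear_op_add: "linear_op f \<Longrightarrow> f (x + y) = f x + f y"
  and linear_op_scale: "linear_op f \<Longrightarrow> f (scale c x) = scale c (f x)"
  by (simp_all add: linear_op_def)

lemma linear_form_zero: "linear_form f \<Longrightarrow> f 0 = 0"
  using linear_form_scale[of f 0 0] by simp

lemma linear_op_zero: "linear_op f \<Longrightarrow> f 0 = 0"
  using linear_op_scale[of f 0 0] by simp

lemma linear_form_sum: "linear_form f \<Longrightarrow> f (\<Sum>i\<in>I. g i) = (\<Sum>i\<in>I. f (g i))"
  by (induction I rule: infinite_finite_induct) (simp_all add: linear_form_add linear_form_zero)

lemma linear_op_sum: "linear_op f \<Longrightarrow> f (\<Sum>i\<in>I. g i) = (\<Sum>i\<in>I. f (g i))"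
  by (induction I rule: infinite_finite_induct) (simp_all add: linear_op_add linear_op_zero)

lemma linear_form_diff: "linear_form f \<Longrightarrow> f (x - y) = f x - f y"
  using linear_form_add[of f "x - y" y] by simp

lemma linear_op_diff: "linear_op f \<Longrightarrow> f (x - y) = f x - f y"
  using linear_op_add[of f "x - y" y] by simp

lemma linear_op_compose: "linear_op f \<Longrightarrow> linear_op g \<Longrightarrow> linear_op (\<lambda>x. f (g x))"
  by (simp add: linear_op_def)

definition coord :: "'b \<Rightarrow> 'b \<Rightarrow> 'a" where
  "coord b x = representation Basis x b"

lemma linear_form_coord: "linear_form (coord b)"
  by (rule linear_formI)
    (simp_all add: coord_def representation_add representation_scale independent_Basis span_Basis)

lemma coord_expansion: "(\<Sum>b\<in>Basis. scale (coord b x) b) = x"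
  unfolding coord_def
  by (rule sum_representation_eq) (auto simp: independent_Basis span_Basis finite_Basis)

lemma linear_form_expansion: "linear_form f \<Longrightarrow> f x = (\<Sum>b\<in>Basis. coord b x * f b)"
  by (subst coord_expansion[of x, symmetric]) (simp only: linear_form_sum linear_form_scale)

lemma bilinear_form_expansion:
  assumes "bilinear_form f"
  shows "f x y = (\<Sum>a\<in>Basis. \<Sum>b\<in>Basis. f a b * (coord a x * coord b y))"
  by (subst linear_form_expansion[OF bilinear_formD(1)[OF assms]],
      subst linear_form_expansion[OF bilinear_formD(2)[OF assms]])
    (simp add: sum_distrib_left mult_ac)

lemma linear_forms_separate:
  assumes "\<And>f. linear_form f \<Longrightarrow> f x = f y"
  shows "x = y"
  by (subst (1 2) coord_expansion[symmetric]) (simp add: assms[OF linear_form_coord])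

definition trace :: "('b \<Rightarrow> 'b) \<Rightarrow> 'a" where
  "trace F = (\<Sum>b\<in>Basis. coord b (F b))"

lemma trace_sum: "trace (\<lambda>x. \<Sum>i\<in>I. F i x) = (\<Sum>i\<in>I. trace (F i))"
  unfolding trace_def by (simp only: linear_form_sum[OF linear_form_coord] sum.swap[of _ I])

lemma trace_scale: "trace (\<lambda>x. scale c (F x)) = c * trace F"
  by (simp add: trace_def linear_form_scale[OF linear_form_coord] sum_distrib_left)

lemma trace_add: "trace (\<lambda>x. F x + G x) = trace F + trace G"
  by (simp add: trace_def linear_form_add[OF linear_form_coord] sum.distrib)

lemma trace_diff: "trace (\<lambda>x. F x - G x) = trace F - trace G"
  by (simp add: trace_def linear_form_diff[OF linear_form_coord] sum_subtractf)

text \<open>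
  The source of all trace computations below: an operator is written as a sum of rank-one operators
  \<open>x \<mapsto> f x v\<close>, and its trace is then the sum of the scalars \<open>f v\<close>.
\<close>

lemma trace_rank_one:
  assumes "linear_form f"
  shows "trace (\<lambda>x. scale (f x) v) = f v"
  unfolding trace_def
  by (subst (2) linear_form_expansion[OF assms])
    (simp add: linear_form_scale[OF linear_form_coord] mult.commute)

lemma trace_commute:
  assumes F: "linear_op F" and G: "linear_op G"
  shows "trace (\<lambda>x. F (G x)) = trace (\<lambda>x. G (F x))"
proof -
  have "F (G x) = (\<Sum>b\<in>Basis. scale (coord b (G x)) (F b))" for x
    by (subst coord_expansion[of "G x", symmetric]) (simp only: linear_op_sum[OF F] linear_op_scale[OF F])
  then have "trace (\<lambda>x. F (G x)) = (\<Sum>b\<in>Basis. trace (\<lambda>x. scale (coord b (G x)) (F b)))"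
    by (simp add: trace_sum)
  also have "\<dots> = (\<Sum>b\<in>Basis. coord b (G (F b)))"
    by (intro sum.cong refl trace_rank_one)
      (use G linear_form_coord in \<open>auto simp: linear_form_def linear_op_def\<close>)
  finally show ?thesis by (simp add: trace_def)
qed

text \<open>
  The number \<open>r\<close> is the rank: expand \<open>P x\<close> in a basis of the range of \<open>P\<close>; on a vector of that
  basis \<open>P\<close> is the identity, so each basis vector contributes \<open>1\<close>.
\<close>

lemma trace_idempotent:
  assumes P: "linear_op P" and idem: "\<And>x. P (P x) = P x"
  obtains r :: nat where "trace P = of_nat r" and "r = 0 \<Longrightarrow> P = (\<lambda>x. 0)"
proof -
  obtain C where C: "C \<subseteq> range P" "independent C" "range P \<subseteq> span C"
    using maximal_independent_subset by blast
  have fin: "finite C" using C(2) by (rule finiteI_independent)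
  have PC: "P x \<in> span C" for x using C(3) by auto
  define f where "f c x = representation C (P x) c" for c x
  have f: "linear_form (f c)" for c
    using C(2) PC by (intro linear_formI)
      (auto simp: f_def linear_op_add[OF P] linear_op_scale[OF P] representation_add representation_scale)
  have "P x = (\<Sum>c\<in>C. scale (f c x) c)" for x
    unfolding f_def using sum_representation_eq[OF C(2) PC fin subset_refl] by simp
  then have "P = (\<lambda>x. \<Sum>c\<in>C. scale (f c x) c)" by blast
  then have "trace P = trace (\<lambda>x. \<Sum>c\<in>C. scale (f c x) c)" by (rule arg_cong)
  also have "\<dots> = (\<Sum>c\<in>C. f c c)"
    by (simp only: trace_sum trace_rank_one[OF f])
  also have "\<dots> = (\<Sum>c\<in>C. 1)"
  proof (rule sum.cong[OF refl])
    fix c assume c: "c \<in> C"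
    then have "P c = c" using C(1) idem by auto
    then show "f c c = 1" by (simp add: f_def representation_basis[OF C(2) c])
  qed
  finally have "trace P = of_nat (card C)" by simp
  moreover have "P = (\<lambda>x. 0)" if "card C = 0"
    using that fin PC by (auto simp: fun_eq_iff)
  ultimately show ?thesis by (rule that)
qed

end

section \<open>Sweedler sums\<close>

locale finite_dim_hopf_algebra = hopf_algebra scale \<Delta> \<epsilon> S + finite_dimensional_vector_space scale Basis
  for scale :: "'k::field \<Rightarrow> 'h::ring_1 \<Rightarrow> 'h" and \<Delta> and \<epsilon> and S and Basis
begin

text \<open>
  \<open>sw h f\<close> stands for \<open>\<Sum> f h\<^sub>1 h\<^sub>2\<close> with scalar values, \<open>swv h f\<close> for the same sum with values in
  the algebra. Identities in the algebra are tested on linear forms, which reduces every Sweedler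
  computation to scalar-valued sums; only for these are the coalgebra axioms restated.
\<close>

definition sw :: "'h \<Rightarrow> ('h \<Rightarrow> 'h \<Rightarrow> 'k) \<Rightarrow> 'k" where
  "sw h f = sweedler (*) f (\<Delta> h)"

definition swv :: "'h \<Rightarrow> ('h \<Rightarrow> 'h \<Rightarrow> 'h) \<Rightarrow> 'h" where
  "swv h f = sweedler scale f (\<Delta> h)"

lemma vector_space_field: "vector_space ((*) :: 'k \<Rightarrow> 'k \<Rightarrow> 'k)"
  by unfold_locales (auto simp: algebra_simps)

lemma sw_sum: "sw h (\<lambda>a b. \<Sum>i\<in>I. f i a b) = (\<Sum>i\<in>I. sw h (f i))"
  by (simp add: sw_def sweedler_def lin_extend_def case_prod_beta sum_distrib_left sum.swap[of _ I])

lemma sw_mult_left: "sw h (\<lambda>a b. c * f a b) = c * sw h f"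
  unfolding sw_def sweedler_def lin_extend_def case_prod_beta sum_distrib_left
  by (rule sum.cong[OF refl]) (rule mult.left_commute)

lemma sw_mult_right: "sw h (\<lambda>a b. f a b * c) = sw h f * c"
  by (simp add: sw_def sweedler_def lin_extend_def case_prod_beta sum_distrib_right mult_ac sum_distrib_left)

lemma sw_add: "sw h (\<lambda>a b. f a b + g a b) = sw h f + sw h g"
  by (simp add: sw_def sweedler_def lin_extend_def case_prod_beta sum.distrib algebra_simps)

lemma sw_diff: "sw h (\<lambda>a b. f a b - g a b) = sw h f - sw h g"
  by (simp add: sw_def sweedler_def lin_extend_def case_prod_beta sum_subtractf algebra_simps)

lemma sw_swap: "sw x (\<lambda>a b. sw y (\<lambda>c d. f a b c d)) = sw y (\<lambda>c d. sw x (\<lambda>a b. f a b c d))"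
  unfolding sw_def sweedler_def lin_extend_def case_prod_beta sum_distrib_left
  by (subst sum.swap) (simp add: mult_ac)

lemma linear_form_swv: "linear_form \<phi> \<Longrightarrow> \<phi> (swv h f) = sw h (\<lambda>a b. \<phi> (f a b))"
  by (simp add: sw_def swv_def sweedler_def lin_extend_def case_prod_beta linear_form_sum linear_form_scale)

lemma sw_tensor2:
  assumes f: "bilinear_form f" and \<Delta>: "\<Delta> h = tensor2 scale p"
  shows "sw h f = lin_extend (*) (\<lambda>(x, y). f x y) p"
  unfolding sw_def \<Delta> by (rule sweedler_tensor2[OF vector_space_field])
    (use f in \<open>simp_all add: bilinear_form_def flip: linear_form_iff\<close>)

lemma comult_rep:
  obtains p where "\<Delta> h = tensor2 scale p" "p \<in> \<Delta> h"
proof -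
  interpret F: vector_space "form_scale :: 'k \<Rightarrow> ('h \<times> 'h \<Rightarrow>\<^sub>0 'k) \<Rightarrow> _"
    by (rule vector_space_form_scale)
  obtain p where "\<Delta> h = tensor2 scale p" using comult_tensor[of h] by blast
  moreover have "p \<in> tensor2 scale p"
    by (simp add: tensor2_def tensor2_null_def F.span_zero)
  ultimately show ?thesis using that by simp
qed

lemma sw_eq_lin_extend:
  assumes f: "bilinear_form f" and p: "p \<in> \<Delta> h"
  shows "sw h f = lin_extend (*) (\<lambda>(x, y). f x y) p"
proof -
  interpret E: Vector_Spaces.linear form_scale "(*)" "lin_extend (*) (\<lambda>(x, y). f x y)"
    by (rule linear_lin_extend[OF vector_space_field])
  obtain q where q: "\<Delta> h = tensor2 scale q" by (rule comult_rep)
  have "lin_extend (*) (\<lambda>(x, y). f x y) (p - q) = 0"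
    by (rule lin_extend_tensor2_null[OF vector_space_field, of scale])
      (use f p q in \<open>simp_all add: bilinear_form_def tensor2_def flip: linear_form_iff\<close>)
  then show ?thesis by (simp add: sw_tensor2[OF f q] E.diff)
qed

lemma linear_form_sw:
  assumes f: "bilinear_form f"
  shows "linear_form (\<lambda>x. sw x f)"
proof -
  interpret E: Vector_Spaces.linear form_scale "(*)" "lin_extend (*) (\<lambda>(x, y). f x y)"
    by (rule linear_lin_extend[OF vector_space_field])
  show ?thesis
  proof (rule linear_formI)
    fix x y
    obtain p q where p: "p \<in> \<Delta> x" and q: "q \<in> \<Delta> y" by (metis comult_rep)
    show "sw (x + y) f = sw x f + sw y f"
      using sw_eq_lin_extend[OF f p] sw_eq_lin_extend[OF f q] sw_eq_lin_extend[OF f comult_add[OF p q]]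
      by (simp add: E.add)
  next
    fix c x
    obtain p where p: "p \<in> \<Delta> x" by (metis comult_rep)
    show "sw (scale c x) f = c * sw x f"
      using sw_eq_lin_extend[OF f p] sw_eq_lin_extend[OF f comult_scale[OF p]]
      by (simp add: E.scale)
  qed
qed

subsection \<open>Linearity rules\<close>

lemma linear_op_id: "linear_op (\<lambda>x. x)"
  by (simp add: linear_op_def)

lemma linear_op_mult_left: "linear_op m \<Longrightarrow> linear_op (\<lambda>x. a * m x)"
  and linear_op_mult_right: "linear_op m \<Longrightarrow> linear_op (\<lambda>x. m x * a)"
  by (simp_all add: linear_op_def algebra_simps scale_mult_left scale_mult_right)

lemma linear_op_S: "linear_op S"
  using antipode_linear by (simp add: linear_op_iff)

lemma linear_op_S': "linear_op m \<Longrightarrow> linear_op (\<lambda>x. S (m x))"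
  using linear_op_S by (rule linear_op_compose)

lemma linear_form_counit: "linear_form \<epsilon>"
  using counit_linear by (simp add: linear_form_iff)

lemma linear_form_compose: "linear_form f \<Longrightarrow> linear_op m \<Longrightarrow> linear_form (\<lambda>x. f (m x))"
  by (simp add: linear_form_def linear_op_def)

lemmas linear_form_counit' = linear_form_compose[OF linear_form_counit]

lemma linear_form_times_const: "linear_form f \<Longrightarrow> linear_form (\<lambda>x. f x * c)"
  and linear_form_const_times: "linear_form f \<Longrightarrow> linear_form (\<lambda>x. c * f x)"
  by (simp_all add: linear_form_def algebra_simps)

lemma linear_form_minus: "linear_form f \<Longrightarrow> linear_form g \<Longrightarrow> linear_form (\<lambda>x. f x - g x)"
  by (simp add: linear_form_def algebra_simps)

lemma linear_form_sw_body: "(\<And>a b. linear_form (\<lambda>x. F x a b)) \<Longrightarrow> linear_form (\<lambda>x. sw h (F x))"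
  unfolding linear_form_def by (simp add: fun_eq_iff arg_cong[of _ _ "sw h"] flip: sw_add sw_mult_left)

lemma linear_form_sw_arg: "linear_op m \<Longrightarrow> bilinear_form f \<Longrightarrow> linear_form (\<lambda>x. sw (m x) f)"
  by (rule linear_form_compose[OF linear_form_sw])

text \<open>
  Linearity side conditions of Sweedler computations are discharged by resolution with these rules:
  the position of the variable inside the term selects the rule, so no search is needed.
\<close>

lemmas lin = bilinear_formI linear_op_id linear_op_mult_left linear_op_mult_right linear_op_S'
  linear_form_counit' linear_form_times_const linear_form_const_times linear_form_minus
  linear_form_sw_body linear_form_sw_arg

lemma linear_op_swv:
  assumes "\<And>\<phi>. linear_form \<phi> \<Longrightarrow> bilinear_form (\<lambda>a b. \<phi> (f a b))"
  shows "linear_op (\<lambda>x. swv x f)"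
proof (rule linear_opI)
  fix x y
  show "swv (x + y) f = swv x f + swv y f"
    by (rule linear_forms_separate)
      (simp add: linear_form_swv linear_form_add linear_form_add[OF linear_form_sw[OF assms]])
next
  fix c x
  show "swv (scale c x) f = scale c (swv x f)"
    by (rule linear_forms_separate)
      (simp add: linear_form_swv linear_form_scale linear_form_scale[OF linear_form_sw[OF assms]])
qed

subsection \<open>The Hopf algebra axioms for Sweedler sums\<close>

lemma lin_extend_tensor3_null:
  assumes 1: "\<And>y z. linear_form (\<lambda>x. f x y z)"
    and 2: "\<And>x z. linear_form (\<lambda>y. f x y z)"
    and 3: "\<And>x y. linear_form (\<lambda>z. f x y z)"
    and p: "p \<in> tensor3_null scale"
  shows "lin_extend (*) (\<lambda>(x, y, z). f x y z) p = 0"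
proof -
  interpret F: vector_space "form_scale :: 'k \<Rightarrow> ('h \<times> 'h \<times> 'h \<Rightarrow>\<^sub>0 'k) \<Rightarrow> _"
    by (rule vector_space_form_scale)
  interpret E: Vector_Spaces.linear form_scale "(*)" "lin_extend (*) (\<lambda>(x, y, z). f x y z)"
    by (rule linear_lin_extend[OF vector_space_field])
  have [simp]: "lin_extend (*) (\<lambda>(x, y, z). f x y z) (pure3 x y z) = f x y z" for x y z
    by (simp add: pure3_def vector_space_field)
  show ?thesis
    using p unfolding tensor3_null_def
  proof (induction rule: F.span_induct_alt)
    case base
    show ?case by (rule E.zero)
  next
    case (step c x y)
    from step(1) have "lin_extend (*) (\<lambda>(x, y, z). f x y z) x = 0"
      by (auto simp: linearity_relations_def E.diff E.scale linear_form_add[OF 1] linear_form_add[OF 2]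
          linear_form_add[OF 3] linear_form_scale[OF 1] linear_form_scale[OF 2] linear_form_scale[OF 3])
    with step show ?case by (simp add: E.add E.scale)
  qed
qed

text \<open>
  A trilinear \<open>f\<close> kills the relations of the threefold tensor product, so it cannot distinguish the
  two representatives that coassociativity identifies.
\<close>

lemma sw_coassoc:
  assumes 1: "\<And>y z. linear_form (\<lambda>x. f x y z)"
    and 2: "\<And>x z. linear_form (\<lambda>y. f x y z)"
    and 3: "\<And>x y. linear_form (\<lambda>z. f x y z)"
  shows "sw h (\<lambda>a b. sw a (\<lambda>c d. f c d b)) = sw h (\<lambda>a b. sw b (\<lambda>c d. f a c d))"
proof -
  let ?E = "lin_extend (*) (\<lambda>(x, y, z). f x y z)"
  interpret F: vector_space "form_scale :: 'k \<Rightarrow> ('h \<times> 'h \<times> 'h \<Rightarrow>\<^sub>0 'k) \<Rightarrow> _"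
    by (rule vector_space_form_scale)
  interpret E: Vector_Spaces.linear form_scale "(*)" ?E
    by (rule linear_lin_extend[OF vector_space_field])
  have [simp]: "?E (pure3 x y z) = f x y z" for x y z
    by (simp add: pure3_def vector_space_field)
  have sw: "?E (sweedler form_scale g t) = sweedler (*) (\<lambda>a b. ?E (g a b)) t" for g and t :: "('h \<times> 'h \<Rightarrow>\<^sub>0 'k) set"
    by (simp add: sweedler_def lin_extend_def[of form_scale] lin_extend_def[of _ _ "tensor_rep t"]
        E.sum E.scale case_prod_beta)
  let ?p = "sweedler form_scale (\<lambda>a b. sweedler form_scale (\<lambda>c d. pure3 c d b) (\<Delta> a)) (\<Delta> h)"
  let ?q = "sweedler form_scale (\<lambda>a b. sweedler form_scale (\<lambda>c d. pure3 a c d) (\<Delta> b)) (\<Delta> h)"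
  have "?p \<in> tensor3 scale ?p"
    by (simp add: tensor3_def tensor3_null_def F.span_zero)
  then have "?p \<in> tensor3 scale ?q" by (simp only: coassoc)
  then have "?p - ?q \<in> tensor3_null scale" by (simp add: tensor3_def)
  from lin_extend_tensor3_null[OF 1 2 3 this] have "?E ?p = ?E ?q" by (simp add: E.diff)
  then show ?thesis by (simp add: sw sw_def)
qed

lemma sw_mult:
  assumes f: "bilinear_form f"
  shows "sw (x * y) f = sw x (\<lambda>a b. sw y (\<lambda>c d. f (a * c) (b * d)))"
proof -
  let ?E = "lin_extend (*) (\<lambda>(x, y). f x y)"
  interpret E: Vector_Spaces.linear form_scale "(*)" ?E
    by (rule linear_lin_extend[OF vector_space_field])
  have [simp]: "?E (pure2 x y) = f x y" for x y
    by (simp add: pure2_def vector_space_field)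
  have sw: "?E (sweedler form_scale g t) = sweedler (*) (\<lambda>a b. ?E (g a b)) t" for g and t :: "('h \<times> 'h \<Rightarrow>\<^sub>0 'k) set"
    by (simp add: sweedler_def lin_extend_def[of form_scale] lin_extend_def[of _ _ "tensor_rep t"]
        E.sum E.scale case_prod_beta)
  show ?thesis
    by (subst sw_tensor2[OF f comult_mult]) (simp add: sw sw_def)
qed

lemma sw_one: "bilinear_form f \<Longrightarrow> sw 1 f = f 1 1"
  by (subst sw_tensor2[OF _ comult_one]) (simp_all add: pure2_def vector_space_field)

lemma sw_counit_left: "linear_form \<phi> \<Longrightarrow> sw h (\<lambda>a b. \<epsilon> a * \<phi> b) = \<phi> h"
  using linear_form_swv[of \<phi> h "\<lambda>a b. scale (\<epsilon> a) b"] counit_left[of h]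
  by (simp add: swv_def linear_form_scale)

lemma sw_counit_right: "linear_form \<phi> \<Longrightarrow> sw h (\<lambda>a b. \<epsilon> b * \<phi> a) = \<phi> h"
  using linear_form_swv[of \<phi> h "\<lambda>a b. scale (\<epsilon> b) a"] counit_right[of h]
  by (simp add: swv_def linear_form_scale)

lemma sw_antipode_left: "linear_form \<phi> \<Longrightarrow> sw h (\<lambda>a b. \<phi> (S a * b)) = \<epsilon> h * \<phi> 1"
  using linear_form_swv[of \<phi> h "\<lambda>a b. S a * b"] antipode_left[of h]
  by (simp add: swv_def linear_form_scale)

lemma sw_antipode_right: "linear_form \<phi> \<Longrightarrow> sw h (\<lambda>a b. \<phi> (a * S b)) = \<epsilon> h * \<phi> 1"
  using linear_form_swv[of \<phi> h "\<lambda>a b. a * S b"] antipode_right[of h]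
  by (simp add: swv_def linear_form_scale)

section \<open>The antipode is an anti-homomorphism of algebras and coalgebras\<close>

lemma antipode_one: "S 1 = 1"
proof (rule linear_forms_separate)
  fix \<phi> assume \<phi>: "linear_form \<phi>"
  note l = lin linear_form_compose[OF \<phi>]
  have "sw 1 (\<lambda>a b. \<phi> (S a * b)) = \<phi> (S 1 * 1)"
    by (rule sw_one) (intro l)
  with sw_antipode_left[OF \<phi>, of 1] show "\<phi> (S 1) = \<phi> 1" by (simp add: counit_one)
qed

text \<open>
  Both sides are convolution inverses of the multiplication map. Concretely, the sum of
  \<open>S (x\<^sub>1 y\<^sub>1) x\<^sub>2 y\<^sub>2 S y\<^sub>3 S x\<^sub>3\<close> collapses to the left side if the last four factors are cancelled,
  and to the right side if the first three are.
\<close>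

lemma antipode_mult: "S (x * y) = S y * S x"
proof (rule linear_forms_separate)
  fix \<phi> assume \<phi>: "linear_form \<phi>"
  note l = lin linear_form_compose[OF \<phi>]
  let ?X = "sw x (\<lambda>a b. sw b (\<lambda>c d. sw y (\<lambda>p q. sw q (\<lambda>r s. \<phi> (S (a * p) * (c * r) * S s * S d)))))"
  have 1: "sw q (\<lambda>r s. \<phi> (S (a * p) * (c * r) * S s * S d)) = \<epsilon> q * \<phi> (S (a * p) * (c * S d))" for q a p c d
    using sw_antipode_right[of "\<lambda>z. \<phi> (S (a * p) * c * z * S d)" q]
    by (simp add: mult.assoc linear_form_compose[OF \<phi>] lin)
  have "?X = sw x (\<lambda>a b. sw b (\<lambda>c d. sw y (\<lambda>p q. \<epsilon> q * \<phi> (S (a * p) * (c * S d)))))"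
    by (simp only: 1)
  also have "\<dots> = sw x (\<lambda>a b. sw b (\<lambda>c d. \<phi> (S (a * y) * (c * S d))))"
    by (subst sw_counit_right) (intro l | rule refl)+
  also have "\<dots> = sw x (\<lambda>a b. \<epsilon> b * \<phi> (S (a * y) * 1))"
    by (subst sw_antipode_right[of "\<lambda>z. \<phi> (S (a * y) * z)" for a]) (intro l | rule refl)+
  also have "\<dots> = \<phi> (S (x * y) * 1)"
    by (subst sw_counit_right) (intro l | rule refl)+
  finally have X1: "?X = \<phi> (S (x * y))" by simp
  have "?X = sw x (\<lambda>u d. sw u (\<lambda>a c. sw y (\<lambda>p q. sw q (\<lambda>r s. \<phi> (S (a * p) * (c * r) * S s * S d)))))"
    by (rule sw_coassoc[symmetric]) (intro l)+
  also have "\<dots> = sw x (\<lambda>u d. sw u (\<lambda>a c. sw y (\<lambda>v s. sw v (\<lambda>p r. \<phi> (S (a * p) * (c * r) * S s * S d)))))"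
    by (subst sw_coassoc) (intro l | rule refl)+
  also have "\<dots> = sw x (\<lambda>u d. sw y (\<lambda>v s. sw u (\<lambda>a c. sw v (\<lambda>p r. \<phi> (S (a * p) * (c * r) * S s * S d)))))"
    by (subst (2) sw_swap) (rule refl)
  also have "\<dots> = sw x (\<lambda>u d. sw y (\<lambda>v s. sw (u * v) (\<lambda>e f. \<phi> (S e * f * S s * S d))))"
    by (subst sw_mult) (intro l | rule refl)+
  also have "\<dots> = sw x (\<lambda>u d. sw y (\<lambda>v s. \<epsilon> (u * v) * \<phi> (1 * S s * S d)))"
    by (subst sw_antipode_left[of "\<lambda>z. \<phi> (z * S s * S d)" for s d]) (intro l | rule refl)+
  also have "\<dots> = sw x (\<lambda>u d. \<epsilon> u * sw y (\<lambda>v s. \<epsilon> v * \<phi> (S s * S d)))"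
    by (simp add: counit_mult sw_mult_left mult.assoc)
  also have "\<dots> = sw x (\<lambda>u d. \<epsilon> u * \<phi> (S y * S d))"
    by (subst sw_counit_left) (intro l | rule refl)+
  also have "\<dots> = \<phi> (S y * S x)"
    by (subst sw_counit_left) (intro l | rule refl)+
  finally show "\<phi> (S (x * y)) = \<phi> (S y * S x)" by (simp add: X1)
qed

text \<open>
  Dual to multiplicativity: the sum of \<open>\<Delta> (S h\<^sub>1) \<Delta> h\<^sub>2 (S h\<^sub>4 \<otimes> S h\<^sub>3)\<close> is evaluated by cancelling
  either its last two or its first two factors.
\<close>

lemma antipode_comult:
  assumes f: "bilinear_form f"
  shows "sw (S h) f = sw h (\<lambda>a b. f (S b) (S a))"
proof -
  note l = lin linear_form_compose[OF bilinear_formD(1)[OF f]] linear_form_compose[OF bilinear_formD(2)[OF f]]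
  let ?g = "\<lambda>p q c e r s. f (p * c * S s) (q * e * S r)"
  let ?X = "sw h (\<lambda>a b. sw (S a) (\<lambda>p q. sw b (\<lambda>c t. sw t (\<lambda>u s. sw u (\<lambda>e r. ?g p q c e r s)))))"
  have 1: "sw u (\<lambda>e r. ?g p q c e r s) = \<epsilon> u * f (p * c * S s) q" for u p q c s
    using sw_antipode_right[of "\<lambda>z. f (p * c * S s) (q * z)" u] by (simp add: mult.assoc l)
  have 2: "sw b (\<lambda>c t. f (p * c * S t) q) = \<epsilon> b * f p q" for b p q
    using sw_antipode_right[of "\<lambda>z. f (p * z) q" b] by (simp add: mult.assoc l)
  have "?X = sw h (\<lambda>a b. sw (S a) (\<lambda>p q. sw b (\<lambda>c t. sw t (\<lambda>u s. \<epsilon> u * f (p * c * S s) q))))"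
    by (simp only: 1)
  also have "\<dots> = sw h (\<lambda>a b. sw (S a) (\<lambda>p q. sw b (\<lambda>c t. f (p * c * S t) q)))"
    by (subst sw_counit_left) (intro l | rule refl)+
  also have "\<dots> = sw h (\<lambda>a b. \<epsilon> b * sw (S a) f)"
    by (simp only: 2 sw_mult_left)
  also have "\<dots> = sw (S h) f"
    by (subst sw_counit_right) (intro l f | rule refl)+
  finally have X1: "?X = sw (S h) f" .
  have "?X = sw h (\<lambda>a b. sw (S a) (\<lambda>p q. sw b (\<lambda>c t. sw t (\<lambda>e w. sw w (\<lambda>r s. ?g p q c e r s)))))"
    by (subst sw_coassoc) (intro l | rule refl)+
  also have "\<dots> = sw h (\<lambda>a b. sw (S a) (\<lambda>p q. sw b (\<lambda>v w. sw v (\<lambda>c e. sw w (\<lambda>r s. ?g p q c e r s)))))"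
    by (subst sw_coassoc) (intro l | rule refl)+
  also have "\<dots> = sw h (\<lambda>a b. sw b (\<lambda>v w. sw (S a) (\<lambda>p q. sw v (\<lambda>c e. sw w (\<lambda>r s. ?g p q c e r s)))))"
    by (subst sw_swap) (rule refl)
  also have "\<dots> = sw h (\<lambda>m w. sw m (\<lambda>a v. sw (S a) (\<lambda>p q. sw v (\<lambda>c e. sw w (\<lambda>r s. ?g p q c e r s)))))"
    by (rule sw_coassoc[symmetric]) (intro l)+
  also have "\<dots> = sw h (\<lambda>m w. sw m (\<lambda>a v. sw (S a * v) (\<lambda>x y. sw w (\<lambda>r s. f (x * S s) (y * S r)))))"
    by (subst sw_mult) (intro l | rule refl)+
  also have "\<dots> = sw h (\<lambda>m w. \<epsilon> m * sw 1 (\<lambda>x y. sw w (\<lambda>r s. f (x * S s) (y * S r))))"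
    by (subst sw_antipode_left) (intro l | rule refl)+
  also have "\<dots> = sw h (\<lambda>m w. \<epsilon> m * sw w (\<lambda>r s. f (1 * S s) (1 * S r)))"
    by (subst sw_one) (intro l | rule refl)+
  also have "\<dots> = sw h (\<lambda>r s. f (1 * S s) (1 * S r))"
    by (rule sw_counit_left) (intro l)
  finally show ?thesis by (simp add: X1)
qed

lemma counit_antipode: "\<epsilon> (S h) = \<epsilon> h"
proof -
  have "\<epsilon> h = sw h (\<lambda>a b. \<epsilon> (S a * b))"
    by (subst sw_antipode_left[OF linear_form_counit]) (simp add: counit_one)
  also have "\<dots> = sw h (\<lambda>a b. \<epsilon> b * \<epsilon> (S a))"
    by (simp add: counit_mult mult.commute)
  also have "\<dots> = \<epsilon> (S h)"
    by (rule sw_counit_right) (intro lin)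
  finally show ?thesis by simp
qed

abbreviation S2 :: "'h \<Rightarrow> 'h" where "S2 h \<equiv> S (S h)"

lemma S2_mult: "S2 (x * y) = S2 x * S2 y"
  by (simp add: antipode_mult)

lemma S2_comult:
  assumes f: "bilinear_form f"
  shows "sw (S2 h) f = sw h (\<lambda>a b. f (S2 a) (S2 b))"
proof -
  note l = lin linear_form_compose[OF bilinear_formD(1)[OF f]] linear_form_compose[OF bilinear_formD(2)[OF f]]
  show ?thesis
    by (subst antipode_comult[OF f], subst antipode_comult) (intro l | rule refl)+
qed

section \<open>Moving a coproduct through a trace\<close>

text \<open>
  This is the cyclicity of the trace for operators that pass through \<open>H \<otimes> H\<close>. Expanding \<open>\<beta>\<close> into
  products of coordinate forms turns the left operator into a combination of \<open>A\<^sub>m \<circ> \<Psi> \<circ> A\<^sub>n\<close>, where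
  \<open>A\<^sub>m x = \<Sum> coord m x\<^sub>1 x\<^sub>2\<close> acts on \<open>H\<close> alone; moving \<open>A\<^sub>n\<close> to the front gives the right operator.
  Its value is that the two copies of the coproduct, which the left side separates by \<open>\<Psi>\<close>, become
  consecutive, so that an antipode hidden in \<open>\<beta>\<close> can cancel.
\<close>

lemma trace_coproduct_swap:
  assumes \<beta>: "bilinear_form \<beta>" and \<Psi>: "linear_op \<Psi>"
  shows "trace (\<lambda>x. swv x (\<lambda>a b. swv (\<Psi> b) (\<lambda>c d. scale (\<beta> c a) d))) =
         trace (\<lambda>x. swv (\<Psi> x) (\<lambda>a b. swv b (\<lambda>c d. scale (\<beta> a c) d)))"
proof -
  define A where "A m x = swv x (\<lambda>a b. scale (coord m a) b)" for m x
  have A_form: "\<phi> (A m x) = sw x (\<lambda>a b. coord m a * \<phi> b)" if "linear_form \<phi>" for \<phi> m x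
    using that by (simp add: A_def linear_form_swv linear_form_scale)
  note l = lin linear_form_coord linear_form_compose[OF linear_form_coord] linear_form_compose[OF _ \<Psi>]
  have A: "linear_op (A m)" for m
    unfolding A_def
    by (rule linear_op_swv) (simp add: linear_form_scale, intro l; simp add: linear_form_def)
  have 1: "swv x (\<lambda>a b. swv (\<Psi> b) (\<lambda>c d. scale (\<beta> c a) d)) =
      (\<Sum>m\<in>Basis. \<Sum>n\<in>Basis. scale (\<beta> m n) (A m (\<Psi> (A n x))))" for x
  proof (rule linear_forms_separate)
    fix \<phi> assume \<phi>: "linear_form \<phi>"
    have lf: "linear_form (\<lambda>y. sw (\<Psi> y) (\<lambda>c d. coord m c * \<phi> d))" for m
      by (intro linear_form_sw_arg \<Psi> l linear_form_compose[OF \<phi>])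
    have "\<phi> (A m (\<Psi> (A n x))) = sw x (\<lambda>a b. coord n a * sw (\<Psi> b) (\<lambda>c d. coord m c * \<phi> d))" for m n
      by (simp add: A_form[OF \<phi>] A_form[OF lf])
    then have "\<phi> (\<Sum>m\<in>Basis. \<Sum>n\<in>Basis. scale (\<beta> m n) (A m (\<Psi> (A n x)))) =
        sw x (\<lambda>a b. sw (\<Psi> b) (\<lambda>c d. (\<Sum>m\<in>Basis. \<Sum>n\<in>Basis. \<beta> m n * (coord m c * coord n a)) * \<phi> d))"
      by (simp add: linear_form_sum[OF \<phi>] linear_form_scale[OF \<phi>] sum_distrib_right sw_sum
          flip: sw_mult_left) (simp add: mult_ac)
    then show "\<phi> (swv x (\<lambda>a b. swv (\<Psi> b) (\<lambda>c d. scale (\<beta> c a) d))) =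
        \<phi> (\<Sum>m\<in>Basis. \<Sum>n\<in>Basis. scale (\<beta> m n) (A m (\<Psi> (A n x))))"
      by (simp add: linear_form_swv \<phi> linear_form_scale bilinear_form_expansion[OF \<beta>, symmetric])
  qed
  have 2: "swv (\<Psi> x) (\<lambda>a b. swv b (\<lambda>c d. scale (\<beta> a c) d)) =
      (\<Sum>m\<in>Basis. \<Sum>n\<in>Basis. scale (\<beta> m n) (A n (A m (\<Psi> x))))" for x
  proof (rule linear_forms_separate)
    fix \<phi> assume \<phi>: "linear_form \<phi>"
    have lf: "linear_form (\<lambda>y. sw y (\<lambda>c d. coord m c * \<phi> d))" for m
      by (intro linear_form_sw l linear_form_compose[OF \<phi>])
    have "\<phi> (A n (A m (\<Psi> x))) = sw (\<Psi> x) (\<lambda>a b. coord m a * sw b (\<lambda>c d. coord n c * \<phi> d))" for m n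
      by (simp add: A_form[OF \<phi>] A_form[OF lf])
    then have "\<phi> (\<Sum>m\<in>Basis. \<Sum>n\<in>Basis. scale (\<beta> m n) (A n (A m (\<Psi> x)))) =
        sw (\<Psi> x) (\<lambda>a b. sw b (\<lambda>c d. (\<Sum>m\<in>Basis. \<Sum>n\<in>Basis. \<beta> m n * (coord m a * coord n c)) * \<phi> d))"
      by (simp add: linear_form_sum[OF \<phi>] linear_form_scale[OF \<phi>] sum_distrib_right sw_sum
          flip: sw_mult_left) (simp add: mult_ac)
    then show "\<phi> (swv (\<Psi> x) (\<lambda>a b. swv b (\<lambda>c d. scale (\<beta> a c) d))) =
        \<phi> (\<Sum>m\<in>Basis. \<Sum>n\<in>Basis. scale (\<beta> m n) (A n (A m (\<Psi> x))))"
      by (simp add: linear_form_swv \<phi> linear_form_scale bilinear_form_expansion[OF \<beta>, symmetric])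
  qed
  have "trace (\<lambda>x. A m (\<Psi> (A n x))) = trace (\<lambda>x. A n (A m (\<Psi> x)))" for m n
    by (rule trace_commute[OF linear_op_compose[OF A \<Psi>] A])
  then show ?thesis by (simp add: 1 2 trace_sum trace_scale)
qed

end

section \<open>The integral of the dual as a twisted trace\<close>

locale finite_dim_hopf_integral = finite_dim_hopf_algebra scale \<Delta> \<epsilon> S Basis
  for scale :: "'k::field \<Rightarrow> 'h::ring_1 \<Rightarrow> 'h" and \<Delta> and \<epsilon> and S and Basis +
  fixes \<Lambda> :: 'h
  assumes integral: "idempotent_integral scale \<epsilon> \<Lambda>"
begin

lemma mult_\<Lambda>: "h * \<Lambda> = scale (\<epsilon> h) \<Lambda>"
  and \<Lambda>_mult: "\<Lambda> * h = scale (\<epsilon> h) \<Lambda>"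
  and counit_\<Lambda>: "\<epsilon> \<Lambda> = 1"
  using integral by (simp_all add: idempotent_integral_def)

lemma sw_mult_\<Lambda>: "bilinear_form f \<Longrightarrow> sw (h * \<Lambda>) f = \<epsilon> h * sw \<Lambda> f"
  and sw_\<Lambda>_mult: "bilinear_form f \<Longrightarrow> sw (\<Lambda> * h) f = \<epsilon> h * sw \<Lambda> f"
  by (simp_all add: mult_\<Lambda> \<Lambda>_mult linear_form_scale[OF linear_form_sw])

text \<open>
  Write the left factor as \<open>S h\<^sub>1 h\<^sub>2 \<Lambda>\<^sub>1 \<otimes> h\<^sub>3 \<Lambda>\<^sub>2\<close>: the integral absorbs \<open>\<Delta> h\<^sub>2\<close> on one reading, and the
  antipode axiom cancels \<open>S h\<^sub>1 h\<^sub>2\<close> on the other.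
\<close>

lemma \<Lambda>_move_left:
  assumes f: "bilinear_form f"
  shows "sw \<Lambda> (\<lambda>a b. f (S h * a) b) = sw \<Lambda> (\<lambda>a b. f a (h * b))"
proof -
  note l = lin linear_form_compose[OF bilinear_formD(1)[OF f]] linear_form_compose[OF bilinear_formD(2)[OF f]]
  have "sw \<Lambda> (\<lambda>a b. f (S h * a) b) = sw h (\<lambda>p q. \<epsilon> q * sw \<Lambda> (\<lambda>a b. f (S p * a) b))"
    by (rule sw_counit_right[symmetric]) (intro l)
  also have "\<dots> = sw h (\<lambda>p q. sw (q * \<Lambda>) (\<lambda>a b. f (S p * a) b))"
    by (subst sw_mult_\<Lambda>) (intro l | rule refl)+
  also have "\<dots> = sw h (\<lambda>p q. sw q (\<lambda>r s. sw \<Lambda> (\<lambda>a b. f (S p * (r * a)) (s * b))))"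
    by (subst sw_mult) (intro l | rule refl)+
  also have "\<dots> = sw h (\<lambda>u s. sw u (\<lambda>p r. sw \<Lambda> (\<lambda>a b. f (S p * r * a) (s * b))))"
    unfolding mult.assoc by (rule sw_coassoc[symmetric]) (intro l)+
  also have "\<dots> = sw h (\<lambda>u s. \<epsilon> u * sw \<Lambda> (\<lambda>a b. f (1 * a) (s * b)))"
    by (subst sw_antipode_left) (intro l | rule refl)+
  also have "\<dots> = sw \<Lambda> (\<lambda>a b. f (1 * a) (h * b))"
    by (rule sw_counit_left) (intro l)
  finally show ?thesis by simp
qed

lemma \<Lambda>_move_right:
  assumes f: "bilinear_form f"
  shows "sw \<Lambda> (\<lambda>a b. f (a * h) b) = sw \<Lambda> (\<lambda>a b. f a (b * S h))"
proof -
  note l = lin linear_form_compose[OF bilinear_formD(1)[OF f]] linear_form_compose[OF bilinear_formD(2)[OF f]]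
  have "sw \<Lambda> (\<lambda>a b. f a (b * S h)) = sw h (\<lambda>p q. \<epsilon> p * sw \<Lambda> (\<lambda>a b. f a (b * S q)))"
    by (rule sw_counit_left[symmetric]) (intro l)
  also have "\<dots> = sw h (\<lambda>p q. sw (\<Lambda> * p) (\<lambda>a b. f a (b * S q)))"
    by (subst sw_\<Lambda>_mult) (intro l | rule refl)+
  also have "\<dots> = sw h (\<lambda>p q. sw p (\<lambda>r s. sw \<Lambda> (\<lambda>a b. f (a * r) (b * s * S q))))"
    by (subst sw_mult, (intro l | rule refl)+, subst sw_swap, rule refl)
  also have "\<dots> = sw h (\<lambda>r q. sw q (\<lambda>s t. sw \<Lambda> (\<lambda>a b. f (a * r) (b * (s * S t)))))"
    unfolding mult.assoc by (rule sw_coassoc) (intro l)+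
  also have "\<dots> = sw h (\<lambda>r q. \<epsilon> q * sw \<Lambda> (\<lambda>a b. f (a * r) (b * 1)))"
    by (subst sw_antipode_right[of "\<lambda>z. sw \<Lambda> (\<lambda>a b. f (a * r) (b * z))" for r]) (intro l | rule refl)+
  also have "\<dots> = sw \<Lambda> (\<lambda>a b. f (a * h) (b * 1))"
    by (rule sw_counit_right) (intro l)
  finally show ?thesis by simp
qed

text \<open>
  A functional which turns out to be an integral of the dual algebra; describing it as a trace
  settles its existence and gives its twisted symmetry \<open>lam_twist\<close> at once.
\<close>

definition lam :: "'h \<Rightarrow> 'k" where
  "lam h = trace (\<lambda>x. h * S2 x)"

text \<open>
  The character of the right regular representation.
\<close>

definition chi :: "'h \<Rightarrow> 'k" where
  "chi h = trace (\<lambda>x. x * h)"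

lemma linear_form_lam: "linear_form lam"
  by (rule linear_formI) (simp_all add: lam_def distrib_right trace_add scale_mult_left trace_scale)

lemma linear_form_chi: "linear_form chi"
  by (rule linear_formI) (simp_all add: chi_def distrib_left trace_add scale_mult_right trace_scale)

lemma lam_\<Lambda>: "lam \<Lambda> = 1"
  by (simp add: lam_def \<Lambda>_mult counit_antipode trace_rank_one linear_form_counit counit_\<Lambda>)

lemma chi_\<Lambda>: "chi \<Lambda> = 1"
  by (simp add: chi_def mult_\<Lambda> trace_rank_one linear_form_counit counit_\<Lambda>)

lemma chi_commute: "chi (x * y) = chi (y * x)"
  using trace_commute[of "\<lambda>z. z * x" "\<lambda>z. z * y"] lin by (simp add: chi_def mult.assoc)

lemma lam_twist: "lam (h * x) = lam (x * S2 h)"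
  using trace_commute[of "\<lambda>z. h * z" "\<lambda>z. x * S2 z"] lin
  by (simp add: lam_def S2_mult mult.assoc)

text \<open>
  For \<open>\<beta> c a = \<phi> (c S a)\<close> and \<open>\<Psi> x = h S\<^sup>2 x\<close>, the left operator of \<open>trace_coproduct_swap\<close> is
  \<open>x \<mapsto> \<Sum> \<phi> (h\<^sub>1 S\<^sup>2 x\<^sub>2 S x\<^sub>1) h\<^sub>2 S\<^sup>2 x\<^sub>3\<close>, in which \<open>S\<^sup>2 x\<^sub>2 S x\<^sub>1 = S (x\<^sub>1 S x\<^sub>2)\<close> cancels; its trace is
  the convolution of \<open>\<phi>\<close> and \<open>lam\<close>. On the right side \<open>\<phi> (y\<^sub>1 S y\<^sub>2)\<close> cancels, which leaves the trace
  of \<open>\<Psi>\<close> times \<open>\<phi> 1\<close>. The square of the antipode is there to make the first cancellation work.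
\<close>

lemma lam_left_integral:
  assumes \<phi>: "linear_form \<phi>"
  shows "sw h (\<lambda>a b. \<phi> a * lam b) = lam h * \<phi> 1"
proof -
  note l = lin linear_form_compose[OF \<phi>] linear_form_lam
  define \<beta> where "\<beta> c a = \<phi> (c * S a)" for c a
  have \<beta>: "bilinear_form \<beta>" unfolding \<beta>_def by (intro l)
  have \<Psi>: "linear_op (\<lambda>x. h * S2 x)" by (intro l)
  have 1: "swv (x) (\<lambda>a b. swv (h * S2 b) (\<lambda>c d. scale (\<beta> c a) d)) =
      swv h (\<lambda>a b. scale (\<phi> a) (b * S2 x))" for x
  proof (rule linear_forms_separate)
    fix \<psi> assume \<psi>: "linear_form \<psi>"
    note l = l linear_form_compose[OF \<psi>]
    have eq: "c * S2 d * S a = c * S (a * S d)" for a c d by (simp add: antipode_mult mult.assoc)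
    have "\<psi> (swv x (\<lambda>a b. swv (h * S2 b) (\<lambda>c d. scale (\<beta> c a) d))) =
        sw x (\<lambda>a b. sw (h * S2 b) (\<lambda>c d. \<phi> (c * S a) * \<psi> d))"
      by (simp add: linear_form_swv \<psi> linear_form_scale \<beta>_def)
    also have "\<dots> = sw x (\<lambda>a b. sw h (\<lambda>p q. sw b (\<lambda>c d. \<phi> (p * S2 c * S a) * \<psi> (q * S2 d))))"
      by (subst sw_mult, (intro l | rule refl)+, subst S2_comult) (intro l | rule refl)+
    also have "\<dots> = sw h (\<lambda>p q. sw x (\<lambda>a b. sw b (\<lambda>c d. \<phi> (p * S2 c * S a) * \<psi> (q * S2 d))))"
      by (subst sw_swap) (rule refl)
    also have "\<dots> = sw h (\<lambda>p q. sw x (\<lambda>u d. sw u (\<lambda>a c. \<phi> (p * S (a * S c)) * \<psi> (q * S2 d))))"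
      unfolding eq by (subst sw_coassoc) (intro l | rule refl)+
    also have "\<dots> = sw h (\<lambda>p q. sw x (\<lambda>u d. \<epsilon> u * (\<phi> (p * S 1) * \<psi> (q * S2 d))))"
      by (subst sw_antipode_right[of "\<lambda>z. \<phi> (p * S z) * \<psi> (q * S2 d)" for p q d]) (intro l | rule refl)+
    also have "\<dots> = sw h (\<lambda>p q. \<phi> (p * S 1) * \<psi> (q * S2 x))"
      by (subst sw_counit_left) (intro l | rule refl)+
    also have "\<dots> = \<psi> (swv h (\<lambda>a b. scale (\<phi> a) (b * S2 x)))"
      by (simp add: linear_form_swv \<psi> linear_form_scale antipode_one)
    finally show "\<psi> (swv x (\<lambda>a b. swv (h * S2 b) (\<lambda>c d. scale (\<beta> c a) d))) =
      \<psi> (swv h (\<lambda>a b. scale (\<phi> a) (b * S2 x)))" .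
  qed
  have 2: "swv y (\<lambda>a b. swv b (\<lambda>c d. scale (\<beta> a c) d)) = scale (\<phi> 1) y" for y
  proof (rule linear_forms_separate)
    fix \<psi> assume \<psi>: "linear_form \<psi>"
    note l = l linear_form_compose[OF \<psi>] \<psi>
    have "\<psi> (swv y (\<lambda>a b. swv b (\<lambda>c d. scale (\<beta> a c) d))) = sw y (\<lambda>a b. sw b (\<lambda>c d. \<phi> (a * S c) * \<psi> d))"
      by (simp add: linear_form_swv \<psi> linear_form_scale \<beta>_def)
    also have "\<dots> = sw y (\<lambda>u d. sw u (\<lambda>a c. \<phi> (a * S c) * \<psi> d))"
      by (subst sw_coassoc) (intro l | rule refl)+
    also have "\<dots> = sw y (\<lambda>u d. \<epsilon> u * (\<phi> 1 * \<psi> d))"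
      by (subst sw_antipode_right[of "\<lambda>z. \<phi> z * \<psi> d" for d]) (intro l \<phi> | rule refl)+
    also have "\<dots> = \<phi> 1 * \<psi> y"
      by (rule sw_counit_left) (intro l)
    finally show "\<psi> (swv y (\<lambda>a b. swv b (\<lambda>c d. scale (\<beta> a c) d))) = \<psi> (scale (\<phi> 1) y)"
      by (simp add: linear_form_scale \<psi>)
  qed
  have "sw h (\<lambda>a b. \<phi> a * lam b) = trace (\<lambda>x. swv h (\<lambda>a b. scale (\<phi> a) (b * S2 x)))"
    unfolding trace_def lam_def
    by (simp add: linear_form_swv linear_form_coord linear_form_scale sum_distrib_left sw_sum)
  also have "\<dots> = trace (\<lambda>x. swv (h * S2 x) (\<lambda>a b. swv b (\<lambda>c d. scale (\<beta> a c) d)))"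
    using trace_coproduct_swap[OF \<beta> \<Psi>] by (simp only: 1)
  also have "\<dots> = lam h * \<phi> 1"
    by (simp add: 2 trace_scale lam_def mult.commute)
  finally show ?thesis .
qed

text \<open>
  The tensor square of the regular representation is a sum of \<open>dim H\<close> copies of it. The trace
  argument for \<open>lam_left_integral\<close> applies with \<open>\<beta> c a = chi (S a c)\<close> and \<open>\<Psi> x = x h\<close>: on the left
  of \<open>trace_coproduct_swap\<close>, \<open>S x\<^sub>1 x\<^sub>2\<close> cancels; on the right, \<open>chi (S y\<^sub>2 y\<^sub>1) = chi (y\<^sub>1 S y\<^sub>2)\<close> does, by
  the symmetry of \<open>chi\<close>.
\<close>

lemma chi_convolution: "sw h (\<lambda>a b. chi a * chi b) = chi 1 * chi h"
proof -
  note l = lin linear_form_compose[OF linear_form_chi]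
  define \<beta> where "\<beta> c a = chi (S a * c)" for c a
  have \<beta>: "bilinear_form \<beta>" unfolding \<beta>_def by (intro l)
  have \<Psi>: "linear_op (\<lambda>x. x * h)" by (intro l)
  have 1: "swv x (\<lambda>a b. swv (b * h) (\<lambda>c d. scale (\<beta> c a) d)) =
      swv h (\<lambda>a b. scale (chi a) (x * b))" for x
  proof (rule linear_forms_separate)
    fix \<psi> assume \<psi>: "linear_form \<psi>"
    note l = l linear_form_compose[OF \<psi>]
    have "\<psi> (swv x (\<lambda>a b. swv (b * h) (\<lambda>c d. scale (\<beta> c a) d))) =
        sw x (\<lambda>a b. sw (b * h) (\<lambda>c d. chi (S a * c) * \<psi> d))"
      by (simp add: linear_form_swv \<psi> linear_form_scale \<beta>_def)
    also have "\<dots> = sw x (\<lambda>a b. sw b (\<lambda>c d. sw h (\<lambda>p q. chi (S a * c * p) * \<psi> (d * q))))"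
      by (subst sw_mult) (intro l | rule refl | simp only: mult.assoc)+
    also have "\<dots> = sw x (\<lambda>u d. sw u (\<lambda>a c. sw h (\<lambda>p q. chi (S a * c * p) * \<psi> (d * q))))"
      by (rule sw_coassoc[symmetric]) (intro l)+
    also have "\<dots> = sw x (\<lambda>u d. \<epsilon> u * sw h (\<lambda>p q. chi (1 * p) * \<psi> (d * q)))"
      by (subst sw_antipode_left) (intro l | rule refl)+
    also have "\<dots> = sw h (\<lambda>p q. chi (1 * p) * \<psi> (x * q))"
      by (rule sw_counit_left) (intro l)
    also have "\<dots> = \<psi> (swv h (\<lambda>a b. scale (chi a) (x * b)))"
      by (simp add: linear_form_swv \<psi> linear_form_scale)
    finally show "\<psi> (swv x (\<lambda>a b. swv (b * h) (\<lambda>c d. scale (\<beta> c a) d))) =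
      \<psi> (swv h (\<lambda>a b. scale (chi a) (x * b)))" .
  qed
  have 2: "swv y (\<lambda>a b. swv b (\<lambda>c d. scale (\<beta> a c) d)) = scale (chi 1) y" for y
  proof (rule linear_forms_separate)
    fix \<psi> assume \<psi>: "linear_form \<psi>"
    note l = l linear_form_compose[OF \<psi>] \<psi>
    have "\<psi> (swv y (\<lambda>a b. swv b (\<lambda>c d. scale (\<beta> a c) d))) = sw y (\<lambda>a b. sw b (\<lambda>c d. chi (a * S c) * \<psi> d))"
      by (simp add: linear_form_swv \<psi> linear_form_scale \<beta>_def chi_commute)
    also have "\<dots> = sw y (\<lambda>u d. sw u (\<lambda>a c. chi (a * S c) * \<psi> d))"
      by (subst sw_coassoc) (intro l | rule refl)+
    also have "\<dots> = sw y (\<lambda>u d. \<epsilon> u * (chi 1 * \<psi> d))"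
      by (subst sw_antipode_right[of "\<lambda>z. chi z * \<psi> d" for d]) (intro l linear_form_chi | rule refl)+
    also have "\<dots> = chi 1 * \<psi> y"
      by (rule sw_counit_left) (intro l)
    finally show "\<psi> (swv y (\<lambda>a b. swv b (\<lambda>c d. scale (\<beta> a c) d))) = \<psi> (scale (chi 1) y)"
      by (simp add: linear_form_scale \<psi>)
  qed
  have "sw h (\<lambda>a b. chi a * trace (\<lambda>x. x * b)) = trace (\<lambda>x. swv h (\<lambda>a b. scale (chi a) (x * b)))"
    unfolding trace_def
    by (simp add: linear_form_swv linear_form_coord linear_form_scale sum_distrib_left sw_sum)
  also have "\<dots> = trace (\<lambda>x. swv (x * h) (\<lambda>a b. swv b (\<lambda>c d. scale (\<beta> a c) d)))"
    using trace_coproduct_swap[OF \<beta> \<Psi>] by (simp only: 1)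
  also have "\<dots> = chi 1 * chi h"
    by (simp only: 2 trace_scale chi_def[of h])
  finally show ?thesis by (simp only: chi_def)
qed

section \<open>Nondegeneracy and the antipode\<close>

text \<open>
  The two formulas say that \<open>\<Delta> \<Lambda>\<close> provides dual bases for the bilinear form \<open>lam (x y)\<close>, up to the
  antipode. Bijectivity of \<open>S\<close>, nondegeneracy of \<open>lam\<close> and of \<open>\<Delta> \<Lambda>\<close>, and the trace formula
  \<open>trace_eq_sw_\<Lambda>\<close> are read off from them.
\<close>

lemma sw_\<Lambda>_lam_left:
  assumes \<phi>: "linear_form \<phi>"
  shows "sw \<Lambda> (\<lambda>a b. \<phi> a * lam (h * b)) = \<phi> (S h)"
proof -
  note l = lin linear_form_compose[OF \<phi>] linear_form_lam linear_form_compose[OF linear_form_lam] \<phi>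
  have "sw \<Lambda> (\<lambda>a b. \<phi> a * lam (h * b)) = sw \<Lambda> (\<lambda>a b. \<phi> (S h * a) * lam b)"
    by (rule \<Lambda>_move_left[symmetric]) (intro l)
  also have "\<dots> = lam \<Lambda> * \<phi> (S h * 1)"
    by (rule lam_left_integral) (intro l)
  finally show ?thesis by (simp add: lam_\<Lambda>)
qed

lemma sw_\<Lambda>_lam_right:
  assumes \<phi>: "linear_form \<phi>"
  shows "sw \<Lambda> (\<lambda>a b. \<phi> a * lam (b * S h)) = \<phi> h"
proof -
  note l = lin linear_form_compose[OF \<phi>] linear_form_lam linear_form_compose[OF linear_form_lam] \<phi>
  have "sw \<Lambda> (\<lambda>a b. \<phi> a * lam (b * S h)) = sw \<Lambda> (\<lambda>a b. \<phi> (a * h) * lam b)"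
    by (rule \<Lambda>_move_right[symmetric]) (intro l)
  also have "\<dots> = lam \<Lambda> * \<phi> (1 * h)"
    by (rule lam_left_integral) (intro l)
  finally show ?thesis by (simp add: lam_\<Lambda>)
qed

lemma bij_S: "bij S"
proof -
  have "x = y" if "S x = S y" for x y
    by (rule linear_forms_separate) (metis sw_\<Lambda>_lam_right that)
  then have "inj S" by (simp add: inj_def)
  then show ?thesis
    using linear_inj_imp_surj[OF linear_op_S[unfolded linear_op_iff]] by (simp add: bij_def)
qed

lemma surj_S: "surj S" using bij_S by (rule bij_is_surj)

lemma S2_surjE: obtains g where "h = S2 g"
proof -
  obtain a where a: "h = S a" using surj_S by (rule surjE)
  obtain g where "a = S g" using surj_S by (rule surjE)
  with a that show ?thesis by simp
qed

lemma linear_op_inv_S: "linear_op m \<Longrightarrow> linear_op (\<lambda>x. inv S (m x))"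
proof -
  have "linear_op (inv S)"
    by (rule linear_opI; rule inv_f_eq[OF bij_is_inj[OF bij_S]])
      (simp_all only: linear_op_add[OF linear_op_S] linear_op_scale[OF linear_op_S] surj_f_inv_f[OF surj_S])
  then show "linear_op m \<Longrightarrow> linear_op (\<lambda>x. inv S (m x))" by (rule linear_op_compose)
qed

lemma lam_nondeg_left: assumes "\<And>x. lam (h * x) = 0" shows "h = 0"
proof -
  have "S h = 0"
  proof (rule linear_forms_separate)
    fix \<phi> assume "linear_form \<phi>"
    from sw_\<Lambda>_lam_left[OF this, of h] show "\<phi> (S h) = \<phi> 0"
      by (simp add: assms sw_def sweedler_def lin_extend_def linear_form_zero[OF \<open>linear_form \<phi>\<close>])
  qed
  then show ?thesis using bij_S linear_op_zero[OF linear_op_S] by (metis bij_is_inj inv_f_f)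
qed

lemma lam_nondeg_right: assumes "\<And>x. lam (x * h) = 0" shows "h = 0"
proof -
  obtain g where g: "h = S2 g" by (rule S2_surjE)
  have "g = 0" by (rule lam_nondeg_left) (simp only: lam_twist[of g] assms flip: g)
  then show ?thesis by (simp add: g linear_op_zero[OF linear_op_S])
qed

lemma \<Lambda>_nondeg_left:
  assumes \<phi>: "linear_form \<phi>" and 0: "\<And>\<psi>. linear_form \<psi> \<Longrightarrow> sw \<Lambda> (\<lambda>a b. \<phi> a * \<psi> b) = 0"
  shows "\<phi> h = 0"
proof -
  obtain g where g: "h = S g" using surj_S by (rule surjE)
  show ?thesis unfolding g sw_\<Lambda>_lam_left[OF \<phi>, symmetric]
    by (rule 0) (intro lin linear_form_compose[OF linear_form_lam])
qed

text \<open>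
  \<open>\<Lambda> S \<Lambda>\<close> is \<open>\<Lambda>\<close> since \<open>\<epsilon> (S \<Lambda>) = 1\<close>, and it is \<open>S \<Lambda>\<close> since \<open>\<Lambda> = S g\<close> turns it into \<open>S (\<Lambda> g)\<close>.
\<close>

lemma S_\<Lambda>: "S \<Lambda> = \<Lambda>"
proof -
  obtain g where g: "\<Lambda> = S g" using surj_S by (rule surjE)
  have "\<epsilon> g = 1" using counit_antipode[of g] counit_\<Lambda> g by simp
  then have "\<Lambda> * S \<Lambda> = S \<Lambda>"
    by (metis \<Lambda>_mult antipode_mult g linear_op_S linear_op_scale scale_one)
  moreover have "\<Lambda> * S \<Lambda> = \<Lambda>" by (simp add: \<Lambda>_mult counit_antipode counit_\<Lambda>)
  ultimately show ?thesis by simp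
qed

lemma \<Lambda>_flip: "bilinear_form f \<Longrightarrow> sw \<Lambda> (\<lambda>a b. f (S b) (S a)) = sw \<Lambda> f"
  using antipode_comult[of f \<Lambda>] by (simp add: S_\<Lambda>)

text \<open>
  Flipping the coproduct of \<open>\<Lambda> = S \<Lambda>\<close> exchanges the two legs; the inverse of \<open>S\<close> is used to reach
  \<open>lam (g _)\<close> as a test form after the flip.
\<close>

lemma \<Lambda>_nondeg_right:
  assumes \<phi>: "linear_form \<phi>" and 0: "\<And>\<psi>. linear_form \<psi> \<Longrightarrow> sw \<Lambda> (\<lambda>a b. \<psi> a * \<phi> b) = 0"
  shows "\<phi> h = 0"
proof -
  obtain g where g: "h = S2 g" by (rule S2_surjE)
  note l = lin linear_form_compose[OF \<phi>] \<phi> linear_op_inv_S linear_form_compose[OF linear_form_lam]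
  have "\<phi> h = sw \<Lambda> (\<lambda>a b. \<phi> (S a) * lam (g * b))"
    unfolding g by (rule sw_\<Lambda>_lam_left[symmetric]) (intro l)
  also have "\<dots> = sw \<Lambda> (\<lambda>a b. lam (g * inv S (S b)) * \<phi> (S a))"
    by (simp add: inv_f_f[OF bij_is_inj[OF bij_S]] mult.commute)
  also have "\<dots> = sw \<Lambda> (\<lambda>a b. lam (g * inv S a) * \<phi> b)"
    by (rule \<Lambda>_flip) (intro l)
  also have "\<dots> = 0" by (rule 0) (intro l)
  finally show ?thesis .
qed

text \<open>
  \<open>sw_\<Lambda>_lam_right\<close> writes the identity, and hence \<open>F\<close>, as a sum of rank-one operators.
\<close>

lemma trace_eq_sw_\<Lambda>:
  assumes F: "linear_op F"
  shows "trace F = sw \<Lambda> (\<lambda>a b. lam (b * S (F a)))"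
proof -
  note l = lin linear_op_compose[OF F] linear_form_compose[OF linear_form_lam]
  have "F x = swv \<Lambda> (\<lambda>a b. scale (lam (b * S x)) (F a))" for x
  proof (rule linear_forms_separate)
    fix \<phi> assume \<phi>: "linear_form \<phi>"
    have "\<phi> (F x) = sw \<Lambda> (\<lambda>a b. \<phi> (F a) * lam (b * S x))"
      by (rule sw_\<Lambda>_lam_right[symmetric]) (intro linear_form_compose[OF \<phi> F])
    then show "\<phi> (F x) = \<phi> (swv \<Lambda> (\<lambda>a b. scale (lam (b * S x)) (F a)))"
      by (simp add: linear_form_swv \<phi> linear_form_scale mult.commute)
  qed
  then have "F = (\<lambda>x. swv \<Lambda> (\<lambda>a b. scale (lam (b * S x)) (F a)))" by blast
  then have "trace F = trace (\<lambda>x. swv \<Lambda> (\<lambda>a b. scale (lam (b * S x)) (F a)))" by (rule arg_cong)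
  also have "\<dots> = sw \<Lambda> (\<lambda>a b. trace (\<lambda>x. scale (lam (b * S x)) (F a)))"
    unfolding trace_def by (simp add: linear_form_swv linear_form_coord linear_form_scale sw_sum)
  also have "\<dots> = sw \<Lambda> (\<lambda>a b. lam (b * S (F a)))"
    by (subst trace_rank_one) (intro l | rule refl)+
  finally show ?thesis .
qed

section \<open>The modular grouplike element\<close>

text \<open>
  Tested against \<open>\<Delta> \<Lambda>\<close>, a left integral \<open>\<psi>\<close> acts only through the number \<open>\<psi> \<Lambda>\<close>.
\<close>

lemma left_integral_unique:
  assumes \<psi>: "linear_form \<psi>"
    and left: "\<And>\<phi> h. linear_form \<phi> \<Longrightarrow> sw h (\<lambda>a b. \<phi> a * \<psi> b) = \<psi> h * \<phi> 1"
  shows "\<psi> h = \<psi> \<Lambda> * lam h"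
proof -
  have "\<psi> h - \<psi> \<Lambda> * lam h = 0"
  proof (rule \<Lambda>_nondeg_right)
    show "linear_form (\<lambda>h. \<psi> h - \<psi> \<Lambda> * lam h)"
      by (intro lin \<psi> linear_form_lam)
    fix \<phi> assume \<phi>: "linear_form \<phi>"
    have "sw \<Lambda> (\<lambda>a b. \<phi> a * (\<psi> b - \<psi> \<Lambda> * lam b)) =
        sw \<Lambda> (\<lambda>a b. \<phi> a * \<psi> b) - \<psi> \<Lambda> * sw \<Lambda> (\<lambda>a b. \<phi> a * lam b)"
      by (simp only: right_diff_distrib sw_diff mult.left_commute[of _ "\<psi> \<Lambda>"] sw_mult_left)
    then show "sw \<Lambda> (\<lambda>a b. \<phi> a * (\<psi> b - \<psi> \<Lambda> * lam b)) = 0"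
      by (simp add: left[OF \<phi>] lam_left_integral[OF \<phi>] lam_\<Lambda>)
  qed
  then show ?thesis by simp
qed

text \<open>
  The distinguished grouplike element; it measures how far \<open>lam\<close> is from being a right integral.
\<close>

definition modular :: 'h where
  "modular = swv \<Lambda> (\<lambda>a b. scale (lam a) b)"

lemma linear_form_modular: "linear_form \<phi> \<Longrightarrow> \<phi> modular = sw \<Lambda> (\<lambda>a b. lam a * \<phi> b)"
  by (simp add: modular_def linear_form_swv linear_form_scale)

text \<open>
  For fixed \<open>\<phi>\<close>, the left side is again a left integral in \<open>h\<close>, so it is a multiple of \<open>lam\<close>.
\<close>

lemma lam_modular:
  assumes \<phi>: "linear_form \<phi>"
  shows "sw h (\<lambda>a b. lam a * \<phi> b) = \<phi> modular * lam h"
proof -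
  note l = lin linear_form_lam \<phi> linear_form_compose[OF \<phi>] linear_form_compose[OF linear_form_lam]
  have lf: "linear_form (\<lambda>h. sw h (\<lambda>a b. lam a * \<phi> b))" by (intro linear_form_sw l)
  have "sw h (\<lambda>a b. \<theta> a * sw b (\<lambda>c d. lam c * \<phi> d)) = sw h (\<lambda>a b. lam a * \<phi> b) * \<theta> 1"
    if \<theta>: "linear_form \<theta>" for \<theta> h
  proof -
    note l = l \<theta> linear_form_compose[OF \<theta>]
    have "sw h (\<lambda>a b. \<theta> a * sw b (\<lambda>c d. lam c * \<phi> d)) = sw h (\<lambda>a b. sw b (\<lambda>c d. \<theta> a * lam c * \<phi> d))"
      by (simp add: mult.assoc sw_mult_left)
    also have "\<dots> = sw h (\<lambda>u d. sw u (\<lambda>a c. \<theta> a * lam c * \<phi> d))"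
      by (rule sw_coassoc[symmetric]) (intro l)+
    also have "\<dots> = sw h (\<lambda>a b. lam a * \<theta> 1 * \<phi> b)"
      by (simp only: sw_mult_right lam_left_integral[OF \<theta>])
    also have "\<dots> = sw h (\<lambda>a b. lam a * \<phi> b * \<theta> 1)"
    proof -
      have "lam a * \<theta> 1 * \<phi> b = lam a * \<phi> b * \<theta> 1" for a b by (simp add: mult_ac)
      then show ?thesis by (simp only:)
    qed
    also have "\<dots> = sw h (\<lambda>a b. lam a * \<phi> b) * \<theta> 1"
      by (rule sw_mult_right)
    finally show ?thesis .
  qed
  from left_integral_unique[OF lf this] show ?thesis
    unfolding linear_form_modular[OF \<phi>] .
qed

lemma counit_modular: "\<epsilon> modular = 1"
  by (simp add: linear_form_modular linear_form_counit mult.commute sw_counit_right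
      linear_form_lam lam_\<Lambda>)

definition grouplike :: "'h \<Rightarrow> bool" where
  "grouplike g \<longleftrightarrow> \<epsilon> g = 1 \<and> (\<forall>f. bilinear_form f \<longrightarrow> sw g f = f g g)"

lemma grouplikeD: "grouplike g \<Longrightarrow> bilinear_form f \<Longrightarrow> sw g f = f g g"
  by (simp add: grouplike_def)

text \<open>
  Convolving \<open>lam\<close> with \<open>\<phi>\<close> and then with \<open>\<psi>\<close> multiplies it by \<open>\<phi> G\<close> and by \<open>\<psi> G\<close>; convolving it
  with the product of \<open>\<phi>\<close> and \<open>\<psi>\<close> multiplies it by the value of that product at \<open>G\<close>. For products
  of forms this is the claim, and products span the bilinear forms.
\<close>

lemma grouplike_modular: "grouplike modular"
  unfolding grouplike_def
proof (intro conjI allI impI counit_modular)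
  fix f assume f: "bilinear_form f"
  have *: "sw modular (\<lambda>a b. \<phi> a * \<psi> b) = \<phi> modular * \<psi> modular"
    if \<phi>: "linear_form \<phi>" and \<psi>: "linear_form \<psi>" for \<phi> \<psi>
  proof -
    note l = lin linear_form_lam \<phi> \<psi> linear_form_compose[OF \<phi>] linear_form_compose[OF \<psi>]
    have "sw modular (\<lambda>a b. \<phi> a * \<psi> b) = sw \<Lambda> (\<lambda>a b. lam a * sw b (\<lambda>c d. \<phi> c * \<psi> d))"
      by (rule linear_form_modular) (intro linear_form_sw l)
    also have "\<dots> = sw \<Lambda> (\<lambda>a b. sw b (\<lambda>c d. lam a * \<phi> c * \<psi> d))"
      by (simp add: mult.assoc sw_mult_left)
    also have "\<dots> = sw \<Lambda> (\<lambda>u d. sw u (\<lambda>a c. lam a * \<phi> c * \<psi> d))"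
      by (rule sw_coassoc[symmetric]) (intro l linear_form_compose[OF linear_form_lam])+
    also have "\<dots> = sw \<Lambda> (\<lambda>u d. \<phi> modular * lam u * \<psi> d)"
      by (simp only: sw_mult_right lam_modular[OF \<phi>])
    also have "\<dots> = \<phi> modular * sw \<Lambda> (\<lambda>u d. lam u * \<psi> d)"
      by (simp only: mult.assoc sw_mult_left)
    finally show ?thesis by (simp add: linear_form_modular[OF \<psi>])
  qed
  have "sw modular f = sw modular (\<lambda>x y. \<Sum>a\<in>Basis. \<Sum>b\<in>Basis. f a b * (coord a x * coord b y))"
    by (simp only: bilinear_form_expansion[OF f, symmetric])
  also have "\<dots> = (\<Sum>a\<in>Basis. \<Sum>b\<in>Basis. f a b * (coord a modular * coord b modular))"
    by (simp only: sw_sum sw_mult_left *[OF linear_form_coord linear_form_coord])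
  also have "\<dots> = f modular modular"
    by (rule bilinear_form_expansion[OF f, symmetric])
  finally show "sw modular f = f modular modular" .
qed

lemma grouplike_antipode:
  assumes g: "grouplike g"
  shows "g * S g = 1"
proof (rule linear_forms_separate)
  fix \<phi> assume \<phi>: "linear_form \<phi>"
  have "sw g (\<lambda>a b. \<phi> (a * S b)) = \<phi> (g * S g)"
    using g by (simp add: grouplike_def lin linear_form_compose[OF \<phi>])
  then show "\<phi> (g * S g) = \<phi> 1"
    using g sw_antipode_right[OF \<phi>, of g] by (simp add: grouplike_def)
qed

lemma grouplike_antipode_left:
  assumes g: "grouplike g"
  shows "S g * g = 1"
proof (rule linear_forms_separate)
  fix \<phi> assume \<phi>: "linear_form \<phi>"
  have "sw g (\<lambda>a b. \<phi> (S a * b)) = \<phi> (S g * g)"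
    using g by (simp add: grouplike_def lin linear_form_compose[OF \<phi>])
  then show "\<phi> (S g * g) = \<phi> 1"
    using g sw_antipode_left[OF \<phi>, of g] by (simp add: grouplike_def)
qed

lemma grouplike_one: "grouplike 1"
  by (simp add: grouplike_def counit_one sw_one)

lemma grouplike_mult:
  assumes g: "grouplike g" and h: "grouplike h"
  shows "grouplike (g * h)"
proof -
  have "sw (g * h) f = f (g * h) (g * h)" if f: "bilinear_form f" for f
  proof -
    note l = lin linear_form_compose[OF bilinear_formD(1)[OF f]] linear_form_compose[OF bilinear_formD(2)[OF f]]
    have "sw (g * h) f = sw g (\<lambda>a b. sw h (\<lambda>c d. f (a * c) (b * d)))" by (rule sw_mult[OF f])
    also have "\<dots> = sw h (\<lambda>c d. f (g * c) (g * d))"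
      by (rule grouplikeD[OF g]) (intro l)
    also have "\<dots> = f (g * h) (g * h)"
      by (rule grouplikeD[OF h]) (intro l)
    finally show ?thesis .
  qed
  with g h show ?thesis by (simp add: grouplike_def counit_mult)
qed

lemma grouplike_power: "grouplike g \<Longrightarrow> grouplike (g ^ n)"
  by (induction n) (simp_all add: grouplike_one grouplike_mult)

text \<open>
  If \<open>g = \<Sum> c\<^sub>x x\<close> with independent \<open>x\<close>, comparing \<open>g \<otimes> g\<close> with \<open>\<Sum> c\<^sub>x x \<otimes> x\<close> in the first leg shows
  \<open>\<phi> x = \<phi> g\<close> for all forms \<open>\<phi>\<close> whenever \<open>c\<^sub>x \<noteq> 0\<close>.
\<close>

lemma independent_grouplikes:
  assumes "finite X" "\<And>g. g \<in> X \<Longrightarrow> grouplike g"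
  shows "independent X"
  using assms
proof (induction X rule: finite_induct)
  case empty
  show ?case by (rule independent_empty)
next
  case (insert g X)
  then have ind: "independent X" and g: "grouplike g" and X: "\<And>x. x \<in> X \<Longrightarrow> grouplike x" by auto
  have "g \<notin> span X"
  proof
    assume "g \<in> span X"
    then obtain c where c: "g = (\<Sum>x\<in>X. scale (c x) x)"
      using span_finite[OF insert.hyps(1)] by auto
    have gp: "sw h (\<lambda>a b. \<phi> a * \<psi> b) = \<phi> h * \<psi> h" if "grouplike h" "linear_form \<phi>" "linear_form \<psi>" for h \<phi> \<psi>
      using that by (simp add: grouplike_def lin)
    have *: "c x * (\<phi> x - \<phi> g) = 0" if \<phi>: "linear_form \<phi>" and x: "x \<in> X" for \<phi> x
    proof -
      have "(\<Sum>x\<in>X. scale (c x * (\<phi> x - \<phi> g)) x) = 0"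
      proof (rule linear_forms_separate)
        fix \<psi> assume \<psi>: "linear_form \<psi>"
        have lf: "linear_form (\<lambda>h. sw h (\<lambda>a b. \<phi> a * \<psi> b))" by (intro linear_form_sw lin \<phi> \<psi>)
        have "\<phi> g * \<psi> g = sw (\<Sum>x\<in>X. scale (c x) x) (\<lambda>a b. \<phi> a * \<psi> b)"
          unfolding c[symmetric] by (rule gp[OF g \<phi> \<psi>, symmetric])
        also have "\<dots> = (\<Sum>x\<in>X. c x * (\<phi> x * \<psi> x))"
          by (simp add: linear_form_sum[OF lf] linear_form_scale[OF lf] gp[OF X \<phi> \<psi>])
        finally have 1: "(\<Sum>x\<in>X. c x * (\<phi> x * \<psi> x)) = \<phi> g * \<psi> g" by simp
        have 2: "(\<Sum>x\<in>X. c x * \<psi> x) = \<psi> g"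
          using arg_cong[OF c, of \<psi>] by (simp add: linear_form_sum[OF \<psi>] linear_form_scale[OF \<psi>])
        have "\<psi> (\<Sum>x\<in>X. scale (c x * (\<phi> x - \<phi> g)) x) =
            (\<Sum>x\<in>X. c x * (\<phi> x * \<psi> x)) - \<phi> g * (\<Sum>x\<in>X. c x * \<psi> x)"
          unfolding sum_distrib_left sum_subtractf[symmetric]
          by (simp add: linear_form_sum[OF \<psi>] linear_form_scale[OF \<psi>] linear_form_diff[OF \<psi>] algebra_simps)
        then show "\<psi> (\<Sum>x\<in>X. scale (c x * (\<phi> x - \<phi> g)) x) = \<psi> 0"
          by (simp add: 1 2 linear_form_zero[OF \<psi>])
      qed
      from independentD[OF ind insert.hyps(1) subset_refl this x] show ?thesis .
    qed
    have "\<exists>x\<in>X. c x \<noteq> 0"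
    proof (rule ccontr)
      assume "\<not> ?thesis"
      then have "g = 0" by (subst c) simp
      then show False using g linear_form_zero[OF linear_form_counit] by (simp add: grouplike_def)
    qed
    then obtain x where x: "x \<in> X" "c x \<noteq> 0" by blast
    have "x = g"
      by (rule linear_forms_separate) (use * x in auto)
    with x insert.hyps show False by simp
  qed
  then show ?case using ind by (simp add: independent_insertI)
qed

text \<open>
  Distinct powers would be infinitely many independent vectors.
\<close>

lemma grouplike_finite_order:
  assumes g: "grouplike g"
  obtains n where "n > 0" "g ^ n = 1"
proof -
  have "\<not> inj (\<lambda>n::nat. g ^ n)"
  proof
    assume inj: "inj (\<lambda>n::nat. g ^ n)"
    let ?X = "(\<lambda>n. g ^ n) ` {..card Basis}"
    have "independent ?X"
      by (rule independent_grouplikes) (auto intro: grouplike_power[OF g])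
    then have "card ?X \<le> card Basis"
      using independent_span_bound[OF finite_Basis, of ?X] by (simp add: span_Basis)
    moreover have "card ?X = Suc (card Basis)"
      using inj by (simp add: card_image inj_on_def)
    ultimately show False by simp
  qed
  then obtain i j where ij: "i < j" "g ^ i = g ^ j"
    unfolding inj_def by (metis linorder_neqE_nat)
  have inv: "S g ^ k * g ^ k = 1" for k
  proof (induction k)
    case (Suc k)
    have "S g ^ Suc k * g ^ Suc k = S g ^ k * (S g * g) * g ^ k"
      by (simp only: power_Suc2[of "S g"] power_Suc[of g] mult.assoc)
    then show ?case using Suc by (simp add: grouplike_antipode_left[OF g])
  qed simp
  have "g ^ (j - i) = S g ^ i * g ^ i * g ^ (j - i)" by (simp add: inv)
  also have "\<dots> = S g ^ i * g ^ j" using ij(1) by (simp add: mult.assoc flip: power_add)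
  also have "\<dots> = 1" by (simp add: inv flip: ij(2))
  finally show ?thesis using ij(1) that[of "j - i"] by simp
qed

text \<open>
  Apply \<open>lam_modular\<close> to \<open>h G\<close> and the form \<open>\<phi> (_ S G)\<close>, using \<open>G S G = 1\<close>.
\<close>

lemma lam_mult_modular_right_integral:
  assumes \<phi>: "linear_form \<phi>"
  shows "sw h (\<lambda>a b. lam (a * modular) * \<phi> b) = lam (h * modular) * \<phi> 1"
proof -
  let ?f = "\<lambda>a b. lam a * \<phi> (b * S modular)"
  note l = lin linear_form_lam linear_form_compose[OF linear_form_lam] linear_form_compose[OF \<phi>] \<phi>
  have f: "bilinear_form ?f" by (intro l)
  have "lam (h * modular) * \<phi> 1 = sw (h * modular) ?f"
    by (subst lam_modular) (intro l, simp add: grouplike_antipode grouplike_modular)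
  also have "\<dots> = sw h (\<lambda>a b. sw modular (\<lambda>c d. ?f (a * c) (b * d)))" by (rule sw_mult[OF f])
  also have "\<dots> = sw h (\<lambda>a b. ?f (a * modular) (b * modular))"
    using grouplike_modular[unfolded grouplike_def] by (simp add: l)
  also have "\<dots> = sw h (\<lambda>a b. lam (a * modular) * \<phi> b)"
    by (simp add: mult.assoc grouplike_antipode grouplike_modular)
  finally show ?thesis by simp
qed

text \<open>
  For a right integral \<open>\<rho>\<close> with \<open>\<rho> \<Lambda> = 1\<close>, pairing \<open>\<Delta> \<Lambda>\<close> with \<open>\<rho> (_ h)\<close> and with \<open>\<rho> (S\<^sup>2 h _)\<close> in the
  first leg gives \<open>S h\<close> in both cases. Left integrals twist on the other side (\<open>lam_twist\<close>).
\<close>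

lemma lam_mult_modular_twist: "lam (x * h * modular) = lam (S2 h * x * modular)"
proof -
  note l = lin linear_form_compose[OF linear_form_lam]
  have lam1: "lam (\<Lambda> * modular) = 1" by (simp add: \<Lambda>_mult counit_modular lam_\<Lambda>)
  have left: "sw \<Lambda> (\<lambda>a b. lam (S h * a * modular) * \<phi> b) = \<phi> h" if \<phi>: "linear_form \<phi>" for h \<phi>
  proof -
    note l = l linear_form_compose[OF \<phi>] \<phi>
    have "sw \<Lambda> (\<lambda>a b. lam (S h * a * modular) * \<phi> b) = sw \<Lambda> (\<lambda>a b. lam (a * modular) * \<phi> (h * b))"
      by (rule \<Lambda>_move_left) (intro l)
    also have "\<dots> = lam (\<Lambda> * modular) * \<phi> (h * 1)"
      by (rule lam_mult_modular_right_integral) (intro l)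
    finally show ?thesis by (simp add: lam1)
  qed
  have right: "sw \<Lambda> (\<lambda>a b. lam (a * h * modular) * \<phi> b) = \<phi> (S h)" if \<phi>: "linear_form \<phi>" for h \<phi>
  proof -
    note l = l linear_form_compose[OF \<phi>] \<phi>
    have "sw \<Lambda> (\<lambda>a b. lam (a * h * modular) * \<phi> b) = sw \<Lambda> (\<lambda>a b. lam (a * modular) * \<phi> (b * S h))"
      by (rule \<Lambda>_move_right) (intro l)
    also have "\<dots> = lam (\<Lambda> * modular) * \<phi> (1 * S h)"
      by (rule lam_mult_modular_right_integral) (intro l)
    finally show ?thesis by (simp add: lam1)
  qed
  have "lam (x * h * modular) - lam (S2 h * x * modular) = 0"
  proof (rule \<Lambda>_nondeg_left[where h = x and \<phi> = "\<lambda>x. lam (x * h * modular) - lam (S2 h * x * modular)"])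
    show "linear_form (\<lambda>x. lam (x * h * modular) - lam (S2 h * x * modular))" by (intro l)
    fix \<psi> assume "linear_form \<psi>"
    then show "sw \<Lambda> (\<lambda>a b. (lam (a * h * modular) - lam (S2 h * a * modular)) * \<psi> b) = 0"
      by (simp add: left_diff_distrib sw_diff left right)
  qed
  then show ?thesis by simp
qed

text \<open>
  With \<open>G\<close> for \<open>modular\<close>, \<open>lam (x h G)\<close> equals \<open>lam (S\<^sup>2 h x G)\<close> by the twist of the right integral,
  and this equals \<open>lam (x G S\<^sup>4 h)\<close> by the twist of the left one; nondegeneracy removes \<open>x\<close>.
\<close>

lemma S4_modular: "h * modular = modular * S2 (S2 h)"
proof -
  have "lam (x * (h * modular - modular * S2 (S2 h))) = 0" for x
  proof -
    have "lam (x * (modular * S2 (S2 h))) = lam (S2 h * x * modular)"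
      using lam_twist[of "S2 h" "x * modular"] by (simp only: mult.assoc)
    also have "\<dots> = lam (x * h * modular)"
      by (rule lam_mult_modular_twist[symmetric])
    finally show ?thesis
      by (simp add: right_diff_distrib linear_form_diff[OF linear_form_lam] mult.assoc)
  qed
  then show ?thesis using lam_nondeg_right by (metis eq_iff_diff_eq_0)
qed

text \<open>
  Moving an element past \<open>modular\<close> costs \<open>S\<^sup>4\<close>; past its \<open>n\<close>-th power, which is \<open>1\<close>, it costs the power
  \<open>2 n\<close> of \<open>S\<^sup>2\<close>.
\<close>

lemma S2_finite_order: obtains n where "n > 0" "\<And>h. (S2 ^^ n) h = h"
proof -
  obtain n where n: "n > 0" "modular ^ n = 1"
    using grouplike_finite_order[OF grouplike_modular] by blast
  have "h * modular ^ k = modular ^ k * (S2 ^^ (2 * k)) h" for k h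
  proof (induction k arbitrary: h)
    case (Suc k)
    have "h * modular ^ Suc k = modular * (S2 (S2 h) * modular ^ k)"
      by (simp add: S4_modular flip: mult.assoc)
    also have "\<dots> = modular ^ Suc k * (S2 ^^ (2 * k)) (S2 (S2 h))"
      by (simp only: Suc[of "S2 (S2 h)"] power_Suc mult.assoc)
    moreover have "2 * Suc k = Suc (Suc (2 * k))" by simp
    ultimately show ?case by (simp only: funpow_Suc_right o_apply)
  qed simp
  from this[of _ n] n have "(S2 ^^ (2 * n)) h = h" for h by simp
  with n(1) show ?thesis using that[of "2 * n"] by simp
qed

text \<open>
  Convolving at \<open>h = 1\<close> gives \<open>lam 1 = lam 1 G\<close>; so a nonzero \<open>lam 1\<close> makes \<open>G\<close> trivial.
\<close>

lemma S2_involutive: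
  assumes "lam 1 \<noteq> 0"
  shows "S2 (S2 h) = h"
proof -
  have "modular = 1"
  proof (rule linear_forms_separate)
    fix \<phi> assume \<phi>: "linear_form \<phi>"
    have "lam 1 * \<phi> 1 = \<phi> modular * lam 1"
      unfolding lam_modular[OF \<phi>, symmetric] by (rule sw_one[symmetric]) (intro lin linear_form_lam \<phi>)
    with assms show "\<phi> modular = \<phi> 1" by simp
  qed
  with S4_modular[of h] show ?thesis by simp
qed

end

section \<open>Sums of ratios of roots of unity\<close>

text \<open>
  Extend \<open>1\<close> to a basis of the field over the rationals and take the coordinate at \<open>1\<close>.
\<close>

lemma additive_retraction_rat:
  obtains \<phi> :: "'k::field_char_0 \<Rightarrow> rat" where "\<And>x y. \<phi> (x + y) = \<phi> x + \<phi> y" "\<phi> 1 = 1"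
proof -
  interpret Q: vector_space "\<lambda>q (x :: 'k). of_rat q * x"
    by unfold_locales (simp_all add: algebra_simps of_rat_add of_rat_mult)
  have ind: "Q.independent {1 :: 'k}" by (simp add: Q.dependent_single)
  note E = Q.independent_extend_basis[OF ind] Q.span_extend_basis[OF ind]
  have "Q.representation (Q.extend_basis {1}) (x + y) 1 =
      Q.representation (Q.extend_basis {1}) x 1 + Q.representation (Q.extend_basis {1}) y 1" for x y :: 'k
    by (subst Q.representation_add) (use E in auto)
  moreover have "Q.representation (Q.extend_basis {1}) (1 :: 'k) 1 = 1"
    using Q.extend_basis_superset[OF ind] by (subst Q.representation_basis[OF E(1)]) auto
  ultimately show ?thesis by (rule that)
qed

text \<open>
  For complex roots of unity the sum is \<open>\<Sum> |\<Sum> \<beta>\<^sub>f|\<^sup>2\<close>, the outer sum over the classes of \<open>c\<close>, and the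
  class of \<open>f0\<close> contributes \<open>1\<close>. Complex conjugation is replaced by translation on the finite group
  \<open>\<Gamma>\<close> of \<open>M\<close>-th roots of unity: if the sum \<open>D\<close> were \<open>0\<close>, the rational-valued function \<open>\<phi>\<close> on \<open>\<Gamma>\<close>
  would satisfy \<open>\<Sum> \<phi> (\<gamma> \<beta>\<^sub>g / \<beta>\<^sub>f) = \<phi> (\<gamma> D) = 0\<close> for every \<open>\<gamma>\<close>, whereas multiplying by \<open>\<phi> \<gamma>\<close> and
  summing over \<open>\<gamma>\<close> yields a sum of rational squares that contains \<open>(\<phi> 1)\<^sup>2\<close>.
\<close>

lemma sum_root_of_unity_ratios_nonzero:
  fixes \<beta> :: "'i \<Rightarrow> 'k::field_char_0"
  assumes fin: "finite F" and M: "M > 0" and unity: "\<And>f. f \<in> F \<Longrightarrow> \<beta> f ^ M = 1"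
    and f0: "f0 \<in> F" and single: "\<And>g. g \<in> F \<Longrightarrow> c g = c f0 \<Longrightarrow> g = f0"
  shows "(\<Sum>f\<in>F. \<Sum>g\<in>F. if c f = c g then \<beta> g / \<beta> f else 0) \<noteq> 0"
proof
  assume zero: "(\<Sum>f\<in>F. \<Sum>g\<in>F. if c f = c g then \<beta> g / \<beta> f else 0) = 0"
  obtain \<phi> :: "'k \<Rightarrow> rat" where add: "\<And>x y. \<phi> (x + y) = \<phi> x + \<phi> y" and one: "\<phi> 1 = 1"
    by (rule additive_retraction_rat) blast
  have \<phi>0: "\<phi> 0 = 0" using add[of 0 0] by simp
  have \<phi>_sum: "\<phi> (\<Sum>i\<in>I. h i) = (\<Sum>i\<in>I. \<phi> (h i))" for h and I :: "'i set"
    by (induction I rule: infinite_finite_induct) (simp_all add: add \<phi>0)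
  define \<Gamma> where "\<Gamma> = {x :: 'k. x ^ M = 1}"
  have fin\<Gamma>: "finite \<Gamma>"
  proof -
    have "monom 1 M - 1 \<noteq> (0 :: 'k poly)"
    proof
      assume "monom 1 M - 1 = (0 :: 'k poly)"
      then have "coeff (monom 1 M) 0 = coeff (1 :: 'k poly) 0" by simp
      with M show False by simp
    qed
    from poly_roots_finite[OF this] show ?thesis by (simp add: \<Gamma>_def poly_monom)
  qed
  have nz: "\<beta> f \<noteq> 0" if "f \<in> F" for f using unity[OF that] M by (auto simp: power_0_left)
  have shift: "(\<Sum>\<gamma>\<in>\<Gamma>. h (\<gamma> * \<beta> f)) = (\<Sum>\<gamma>\<in>\<Gamma>. h \<gamma>)" if f: "f \<in> F" for f and h :: "'k \<Rightarrow> rat"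
    by (rule sum.reindex_bij_witness[of _ "\<lambda>\<gamma>. \<gamma> / \<beta> f" "\<lambda>\<gamma>. \<gamma> * \<beta> f"])
      (use nz[OF f] unity[OF f] in \<open>auto simp: \<Gamma>_def power_mult_distrib power_divide\<close>)
  have ratio: "(\<Sum>\<gamma>\<in>\<Gamma>. \<phi> \<gamma> * \<phi> (\<gamma> * (\<beta> g / \<beta> f))) = (\<Sum>\<gamma>\<in>\<Gamma>. \<phi> (\<gamma> * \<beta> f) * \<phi> (\<gamma> * \<beta> g))"
    if "f \<in> F" for f g
    using shift[OF that, of "\<lambda>\<gamma>. \<phi> \<gamma> * \<phi> (\<gamma> * (\<beta> g / \<beta> f))"] nz[OF that] by simp
  have "0 = (\<Sum>\<gamma>\<in>\<Gamma>. \<phi> \<gamma> * \<phi> (\<gamma> * (\<Sum>f\<in>F. \<Sum>g\<in>F. if c f = c g then \<beta> g / \<beta> f else 0)))"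
    by (simp add: zero \<phi>0)
  also have "\<dots> = (\<Sum>\<gamma>\<in>\<Gamma>. \<Sum>f\<in>F. \<Sum>g\<in>F. if c f = c g then \<phi> \<gamma> * \<phi> (\<gamma> * (\<beta> g / \<beta> f)) else 0)"
    by (simp add: sum_distrib_left \<phi>_sum if_distrib[of "\<lambda>x. \<gamma> * x" for \<gamma>] if_distrib[of \<phi>] \<phi>0
        if_distrib[of "\<lambda>x. q * x" for q :: rat] cong: if_cong)
  also have "\<dots> = (\<Sum>f\<in>F. \<Sum>g\<in>F. if c f = c g then (\<Sum>\<gamma>\<in>\<Gamma>. \<phi> \<gamma> * \<phi> (\<gamma> * (\<beta> g / \<beta> f))) else 0)"
    by (subst sum.swap, rule sum.cong[OF refl], subst sum.swap, rule sum.cong[OF refl]) simp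
  also have "\<dots> = (\<Sum>f\<in>F. \<Sum>g\<in>F. if c f = c g then (\<Sum>\<gamma>\<in>\<Gamma>. \<phi> (\<gamma> * \<beta> f) * \<phi> (\<gamma> * \<beta> g)) else 0)"
    by (intro sum.cong refl if_cong ratio)
  also have "\<dots> = (\<Sum>\<gamma>\<in>\<Gamma>. \<Sum>f\<in>F. \<Sum>g\<in>F. if c f = c g then \<phi> (\<gamma> * \<beta> f) * \<phi> (\<gamma> * \<beta> g) else 0)"
    by (subst sum.swap[of _ _ \<Gamma>], rule sum.cong[OF refl], subst sum.swap[of _ _ \<Gamma>], rule sum.cong[OF refl]) simp
  also have "\<dots> = (\<Sum>\<gamma>\<in>\<Gamma>. \<Sum>d\<in>c ` F. (\<Sum>f | f \<in> F \<and> c f = d. \<phi> (\<gamma> * \<beta> f))\<^sup>2)"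
  proof (rule sum.cong[OF refl])
    fix \<gamma>
    have "(\<Sum>d\<in>c ` F. (\<Sum>f | f \<in> F \<and> c f = d. \<phi> (\<gamma> * \<beta> f))\<^sup>2) =
        (\<Sum>d\<in>c ` F. \<Sum>f | f \<in> F \<and> c f = d. \<phi> (\<gamma> * \<beta> f) * (\<Sum>g | g \<in> F \<and> c g = d. \<phi> (\<gamma> * \<beta> g)))"
      by (simp add: power2_eq_square sum_distrib_right)
    also have "\<dots> = (\<Sum>d\<in>c ` F. \<Sum>f | f \<in> F \<and> c f = d. \<phi> (\<gamma> * \<beta> f) * (\<Sum>g | g \<in> F \<and> c f = c g. \<phi> (\<gamma> * \<beta> g)))"
      by (intro sum.cong refl arg_cong2[where f = "(*)"]) auto
    also have "\<dots> = (\<Sum>f\<in>F. \<phi> (\<gamma> * \<beta> f) * (\<Sum>g | g \<in> F \<and> c f = c g. \<phi> (\<gamma> * \<beta> g)))"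
      by (rule sum.image_gen[OF fin, symmetric])
    also have "\<dots> = (\<Sum>f\<in>F. \<Sum>g\<in>F. if c f = c g then \<phi> (\<gamma> * \<beta> f) * \<phi> (\<gamma> * \<beta> g) else 0)"
      by (intro sum.cong refl) (simp add: sum.inter_filter[OF fin] sum_distrib_left if_distrib cong: if_cong)
    finally show "(\<Sum>f\<in>F. \<Sum>g\<in>F. if c f = c g then \<phi> (\<gamma> * \<beta> f) * \<phi> (\<gamma> * \<beta> g) else 0) =
      (\<Sum>d\<in>c ` F. (\<Sum>f | f \<in> F \<and> c f = d. \<phi> (\<gamma> * \<beta> f))\<^sup>2)" by simp
  qed
  finally have sq: "(\<Sum>\<gamma>\<in>\<Gamma>. \<Sum>d\<in>c ` F. (\<Sum>f | f \<in> F \<and> c f = d. \<phi> (\<gamma> * \<beta> f))\<^sup>2) = 0" by simp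
  then have "\<forall>\<gamma>\<in>\<Gamma>. (\<Sum>d\<in>c ` F. (\<Sum>f | f \<in> F \<and> c f = d. \<phi> (\<gamma> * \<beta> f))\<^sup>2) = 0"
    by (subst (asm) sum_nonneg_eq_0_iff[OF fin\<Gamma>]) (auto intro: sum_nonneg)
  moreover have "1 / \<beta> f0 \<in> \<Gamma>" by (simp add: \<Gamma>_def power_divide unity[OF f0])
  ultimately have "(\<Sum>d\<in>c ` F. (\<Sum>f | f \<in> F \<and> c f = d. \<phi> (1 / \<beta> f0 * \<beta> f))\<^sup>2) = 0" by blast
  then have "(\<Sum>f | f \<in> F \<and> c f = c f0. \<phi> (1 / \<beta> f0 * \<beta> f))\<^sup>2 = 0"
    by (subst (asm) sum_nonneg_eq_0_iff) (use fin f0 in auto)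
  moreover have "{f \<in> F. c f = c f0} = {f0}" using f0 single by auto
  ultimately show False using nz[OF f0] one by simp
qed

section \<open>Nonvanishing of the twisted trace\<close>

locale semisimple_hopf_algebra = finite_dim_hopf_integral scale \<Delta> \<epsilon> S Basis \<Lambda>
  for scale :: "'k::{alg_closed_field, field_char_0} \<Rightarrow> 'h::ring_1 \<Rightarrow> 'h"
    and \<Delta> and \<epsilon> and S and Basis and \<Lambda> +
  assumes semisimple: "semisimple_ring TYPE('h)"
begin

text \<open>
  Semisimple rings are von Neumann regular: split \<open>1\<close> along \<open>H x\<close> and a complement.
\<close>

lemma regular: obtains y where "x * y * x = (x :: 'h)"
proof -
  let ?I = "range (\<lambda>a. a * x)"
  have "left_ideal ?I"
    unfolding left_ideal_def
  proof (intro conjI ballI allI)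
    show "0 \<in> ?I" by (rule range_eqI[of _ _ 0]) simp
  next
    fix u v assume "u \<in> ?I" "v \<in> ?I"
    then obtain a b where "u = a * x" "v = b * x" by blast
    then show "u + v \<in> ?I" by (intro range_eqI[of _ _ "a + b"]) (simp add: distrib_right)
  next
    fix b u assume "u \<in> ?I"
    then obtain a where "u = a * x" by blast
    then show "b * u \<in> ?I" by (intro range_eqI[of _ _ "b * a"]) (simp add: mult.assoc)
  qed
  then obtain J where J: "left_ideal J" "?I \<inter> J = {0}" "{u + v | u v. u \<in> ?I \<and> v \<in> J} = UNIV"
    using semisimple unfolding semisimple_ring_def by (elim allE[of _ ?I]) auto
  from J(3) have "1 \<in> {u + v | u v. u \<in> ?I \<and> v \<in> J}" by blast
  then obtain a j where aj: "1 = a * x + j" "j \<in> J" by blast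
  have "x * j = x * (a * x + j) - x * a * x"
    by (simp add: distrib_left mult.assoc)
  then have xj: "x * j = x - x * a * x" by (simp flip: aj(1))
  also have "\<dots> = (1 - x * a) * x" by (simp add: left_diff_distrib)
  finally have "x * j \<in> ?I" by (rule range_eqI)
  moreover have "x * j \<in> J" using J(1) aj(2) by (simp add: left_ideal_def)
  ultimately have "x * j \<in> {0}" unfolding J(2)[symmetric] by (rule IntI)
  with xj have "x * a * x = x" by simp
  then show ?thesis by (rule that)
qed

subsection \<open>An element implementing the square of the antipode\<close>

text \<open>
  On a matrix block \<open>S\<^sup>2\<close> is conjugation by a matrix, and this element is a multiple of the inverse
  of that matrix. It is obtained by comparing the regular character, which is symmetric, with
  \<open>lam\<close>, which is twisted by \<open>S\<^sup>2\<close>.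
\<close>

definition twister :: 'h where
  "twister = swv \<Lambda> (\<lambda>a b. b * S a)"

lemma linear_form_twister: "linear_form \<phi> \<Longrightarrow> \<phi> twister = sw \<Lambda> (\<lambda>a b. \<phi> (b * S a))"
  by (simp add: twister_def linear_form_swv)

lemma chi_eq_lam: "chi x = lam (twister * S x)"
proof -
  note l = lin linear_form_compose[OF linear_form_lam]
  have "chi x = sw \<Lambda> (\<lambda>a b. lam (b * S (a * x)))"
    unfolding chi_def by (rule trace_eq_sw_\<Lambda>) (intro l)
  also have "\<dots> = sw \<Lambda> (\<lambda>a b. lam (b * (S x * S a)))"
    by (simp add: antipode_mult)
  also have "\<dots> = sw \<Lambda> (\<lambda>a b. lam (S a * (S x * S2 b)))"
    by (rule \<Lambda>_flip[symmetric]) (intro l)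
  also have "\<dots> = sw \<Lambda> (\<lambda>a b. lam (b * S a * S x))"
    by (simp only: mult.assoc lam_twist[of _ "S a * S x" for a])
  also have "\<dots> = lam (twister * S x)"
    by (rule linear_form_twister[of "\<lambda>z. lam (z * S x)", symmetric]) (intro l)
  finally show ?thesis .
qed

lemma S2_twister: "S2 twister = twister"
proof (rule linear_forms_separate)
  fix \<phi> assume \<phi>: "linear_form \<phi>"
  note l = lin linear_form_compose[OF \<phi>]
  have "\<phi> (S2 twister) = sw \<Lambda> (\<lambda>a b. \<phi> (S2 (b * S a)))"
    by (rule linear_form_twister) (intro l)
  also have "\<dots> = sw \<Lambda> (\<lambda>a b. \<phi> (S2 b * S (S2 a)))"
    by (simp add: antipode_mult)
  also have "\<dots> = sw (S2 \<Lambda>) (\<lambda>a b. \<phi> (b * S a))"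
    by (rule S2_comult[symmetric]) (intro l)
  also have "\<dots> = \<phi> twister" by (simp add: S_\<Lambda> linear_form_twister[OF \<phi>])
  finally show "\<phi> (S2 twister) = \<phi> twister" .
qed

lemma lam_twister: "lam (twister * x) = lam (x * twister)"
  by (subst lam_twist) (simp add: S2_twister)

text \<open>
  Symmetry of \<open>chi\<close> says that \<open>lam (w a b) = lam (w b a)\<close>. Moving \<open>w x\<close> past \<open>a\<close> on one side of
  \<open>lam\<close> costs \<open>S\<^sup>2\<close>, and nondegeneracy removes \<open>a\<close>.
\<close>

lemma twister_S2: "x * twister = twister * S2 x"
proof -
  have comm: "lam (twister * (a * b)) = lam (twister * (b * a))" for a b
  proof -
    obtain a' b' where ab: "a = S a'" "b = S b'" by (metis surjE[OF surj_S])
    show ?thesis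
      using chi_eq_lam[of "b' * a'"] chi_eq_lam[of "a' * b'"] chi_commute[of a' b']
      by (simp add: ab antipode_mult)
  qed
  have "lam (a * (x * twister)) = lam (a * (twister * S2 x))" for a
  proof -
    have "lam (a * (x * twister)) = lam (twister * (a * x))"
      by (simp only: lam_twister mult.assoc)
    also have "\<dots> = lam (twister * x * a)" by (simp only: comm mult.assoc)
    also have "\<dots> = lam (a * S2 (twister * x))" by (rule lam_twist)
    finally show ?thesis by (simp only: S2_mult S2_twister)
  qed
  then have "lam (a * (x * twister - twister * S2 x)) = 0" for a
    by (simp add: right_diff_distrib linear_form_diff[OF linear_form_lam])
  from lam_nondeg_right[OF this] show ?thesis by simp
qed

text \<open>
  If \<open>f w = 0\<close>, then the regular character vanishes on the idempotent \<open>S\<^sup>-\<^sup>1 f\<close>. Its value there is a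
  rank, and in characteristic zero a rank that vanishes as a scalar is \<open>0\<close>.
\<close>

lemma idempotent_twister_nonzero:
  assumes f: "f * f = f" and 0: "f * twister = 0"
  shows "f = 0"
proof -
  obtain e where e: "f = S e" using surj_S by (rule surjE)
  have "S (e * e) = S e" using f by (simp add: antipode_mult e)
  then have ee: "e * e = e" using bij_S by (simp add: bij_is_inj inj_eq)
  have "chi e = 0"
    by (simp add: chi_eq_lam lam_twister 0 linear_form_zero[OF linear_form_lam] flip: e)
  moreover obtain r where "trace (\<lambda>x. x * e) = of_nat r" "r = 0 \<Longrightarrow> (\<lambda>x. x * e) = (\<lambda>x. 0)"
  proof (rule trace_idempotent)
    show "linear_op (\<lambda>x. x * e)" by (intro lin)
  qed (simp_all add: mult.assoc ee)
  ultimately have "(\<lambda>x. x * e) = (\<lambda>x. 0)" by (simp add: chi_def)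
  then have "e = 0" by (metis mult_1)
  then show ?thesis by (simp add: e linear_op_zero[OF linear_op_S])
qed

subsection \<open>Primitive idempotents of the fixed ring\<close>

lemma S2_power_mult: "(S2 ^^ k) (x * y) = (S2 ^^ k) x * (S2 ^^ k) y"
  by (induction k) (simp_all add: antipode_mult)

lemma S2_power_fixed: "S2 x = x \<Longrightarrow> (S2 ^^ k) x = x"
  by (induction k) simp_all

lemma linear_op_S2: "linear_op S2"
  by (intro lin)

lemma S2_add: "S2 (x + y) = S2 x + S2 y" and S2_diff: "S2 (x - y) = S2 x - S2 y"
  and S2_scale: "S2 (scale c x) = scale c (S2 x)" and S2_zero: "S2 0 = 0" and S2_one: "S2 1 = 1"
  by (simp_all add: linear_op_add[OF linear_op_S] linear_op_diff[OF linear_op_S] linear_op_scale[OF linear_op_S]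
      linear_op_zero[OF linear_op_S] antipode_one)

text \<open>
  Averaging a quasi-inverse over the finite cyclic group generated by \<open>S\<^sup>2\<close> makes it invariant.
\<close>

lemma regular_fixed:
  assumes x: "S2 x = x"
  obtains y where "S2 y = y" "x * y * x = x"
proof -
  obtain z where z: "x * z * x = x" by (rule regular)
  obtain n where n: "n > 0" "\<And>h. (S2 ^^ n) h = h" using S2_finite_order by blast
  define s where "s = (\<Sum>k<n. (S2 ^^ k) z)"
  have "S2 s = (\<Sum>k<n. (S2 ^^ Suc k) z)"
    unfolding s_def by (simp add: linear_op_sum[OF linear_op_S2])
  also have "\<dots> = (\<Sum>k<Suc n. (S2 ^^ k) z) - z"
    by (subst sum.lessThan_Suc_shift) simp
  also have "\<dots> = s" by (simp only: sum.lessThan_Suc n(2) s_def) simp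
  finally have S2s: "S2 s = s" .
  have "x * (S2 ^^ k) z * x = x" for k
  proof -
    have "x * (S2 ^^ k) z * x = (S2 ^^ k) (x * z * x)"
      by (simp only: S2_power_mult S2_power_fixed[OF x])
    then show ?thesis by (simp only: z S2_power_fixed[OF x])
  qed
  then have "x * s * x = (\<Sum>k<n. x)"
    unfolding s_def sum_distrib_left sum_distrib_right by simp
  also have "\<dots> = scale (of_nat n) x"
    by (induction n) (simp_all add: scale_left_distrib distrib_right)
  finally have "x * scale (1 / of_nat n) s * x = x"
    using n(1) by (simp add: scale_mult_left scale_mult_right)
  moreover have "S2 (scale (1 / of_nat n) s) = scale (1 / of_nat n) s"
    by (simp add: S2_scale S2s)
  ultimately show ?thesis using that by blast
qed

text \<open>
  Primitive among the idempotents fixed by \<open>S\<^sup>2\<close>, not among all idempotents. Working in the fixed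
  ring makes \<open>twister\<close> act on such idempotents by scalars.
\<close>

definition primitive :: "'h \<Rightarrow> bool" where
  "primitive f \<longleftrightarrow> f \<noteq> 0 \<and> f * f = f \<and> S2 f = f \<and>
     (\<forall>e. e * e = e \<and> S2 e = e \<and> f * e = e \<and> e * f = e \<longrightarrow> e = 0 \<or> e = f)"

lemma primitiveD:
  assumes "primitive f"
  shows "f \<noteq> 0" "f * f = f" "S2 f = f"
    and "\<And>e. e * e = e \<Longrightarrow> S2 e = e \<Longrightarrow> f * e = e \<Longrightarrow> e * f = e \<Longrightarrow> e \<noteq> 0 \<Longrightarrow> e = f"
  using assms unfolding primitive_def by blast+

definition orthogonal_decomposition :: "'h set \<Rightarrow> bool" where
  "orthogonal_decomposition F \<longleftrightarrow> finite F \<and> 0 \<notin> F \<and> (\<forall>f\<in>F. f * f = f \<and> S2 f = f) \<and>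
     (\<forall>f\<in>F. \<forall>g\<in>F. f \<noteq> g \<longrightarrow> f * g = 0) \<and> \<Sum>F = 1"

lemma card_orthogonal_decomposition:
  assumes F: "orthogonal_decomposition F"
  shows "card F \<le> card Basis"
proof -
  have fin: "finite F" using F by (simp add: orthogonal_decomposition_def)
  have "independent F"
  proof (rule independent_if_scalars_zero[OF fin])
    fix c g assume zero: "(\<Sum>f\<in>F. scale (c f) f) = 0" and g: "g \<in> F"
    have "0 = (\<Sum>f\<in>F. scale (c f) f) * g" by (simp add: zero)
    also have "\<dots> = (\<Sum>f\<in>F. scale (c f) (f * g))" by (simp add: sum_distrib_right scale_mult_left)
    also have "\<dots> = (\<Sum>f\<in>F. if f = g then scale (c g) g else 0)"
      using F g by (intro sum.cong) (auto simp: orthogonal_decomposition_def)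
    also have "\<dots> = scale (c g) g" using fin g by simp
    finally show "c g = 0" using F g by (auto simp: orthogonal_decomposition_def)
  qed
  then show ?thesis using independent_span_bound[OF finite_Basis, of F] by (simp add: span_Basis)
qed

lemma split_orthogonal_decomposition:
  assumes F: "orthogonal_decomposition F" and f: "f \<in> F"
    and e: "e * e = e" "S2 e = e" "f * e = e" "e * f = e" "e \<noteq> 0" "e \<noteq> f"
  obtains F' where "orthogonal_decomposition F'" "card F' = Suc (card F)"
proof -
  let ?G = "F - {f}" and ?d = "f - e"
  have fin: "finite F" and ff: "f * f = f" "S2 f = f" "f \<noteq> 0" and sum: "\<Sum>F = 1"
    using F f by (auto simp: orthogonal_decomposition_def)
  have G: "g * g = g" "S2 g = g" "f * g = 0" "g * f = 0" "g \<noteq> 0" if "g \<in> ?G" for g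
    using F f that by (auto simp: orthogonal_decomposition_def)
  have Ge: "e * g = 0" "g * e = 0" if "g \<in> ?G" for g
  proof -
    have "e * g = e * (f * g)" by (simp add: e(4) flip: mult.assoc)
    then show "e * g = 0" by (simp add: G[OF that])
    have "g * e = g * f * e" by (simp add: e(3) mult.assoc)
    then show "g * e = 0" by (simp add: G[OF that])
  qed
  have d: "?d * ?d = ?d" "S2 ?d = ?d" "e * ?d = 0" "?d * e = 0" "?d \<noteq> 0"
    using e ff by (simp_all add: algebra_simps S2_diff)
  have Gd: "?d * g = 0" "g * ?d = 0" if "g \<in> ?G" for g
    using G[OF that] Ge[OF that] by (simp_all add: algebra_simps)
  have notin: "e \<notin> ?G" "?d \<notin> ?G" "e \<noteq> ?d"
    using Ge[of e] Gd[of ?d] d(1,3,5) e(1,5) by auto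
  let ?F = "insert e (insert ?d ?G)"
  have "\<Sum>?F = e + (?d + \<Sum>?G)" using fin notin by simp
  also have "\<dots> = \<Sum>F" by (simp add: sum.remove[OF fin f])
  finally have 1: "\<Sum>?F = 1" by (simp add: sum)
  have GG: "g * h = 0" if "g \<in> ?G" "h \<in> ?G" "g \<noteq> h" for g h
    using F that by (auto simp: orthogonal_decomposition_def)
  have 2: "g * h = 0" if gh: "g \<in> ?F" "h \<in> ?F" "g \<noteq> h" for g h
  proof -
    have h: "h = e \<or> h = ?d \<or> h \<in> ?G" using gh(2) by blast
    consider "g = e" | "g = ?d" | "g \<in> ?G" using gh(1) by blast
    then show ?thesis
    proof cases
      case 1
      with h d(3) Ge(1) gh(3) show ?thesis by metis
    next
      case 2
      with h d(4) Gd(1) gh(3) show ?thesis by metis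
    next
      case 3
      with h Ge(2) Gd(2) GG gh(3) show ?thesis by metis
    qed
  qed
  have 3: "g * g = g \<and> S2 g = g \<and> g \<noteq> 0" if g: "g \<in> ?F" for g
  proof -
    consider "g = e" | "g = ?d" | "g \<in> ?G" using g by blast
    then show ?thesis
    proof cases
      case 1
      with e show ?thesis by simp
    next
      case 2
      show ?thesis unfolding 2 using d by blast
    next
      case 3
      with G show ?thesis by blast
    qed
  qed
  have 4: "finite ?F" using fin by simp
  have "orthogonal_decomposition ?F"
    unfolding orthogonal_decomposition_def
  proof (intro conjI ballI impI)
    show "finite ?F" by (rule 4)
    show "0 \<notin> ?F" using 3[of 0] by blast
    show "\<Sum>?F = 1" by (rule 1)
  next
    fix g assume "g \<in> ?F"
    from 3[OF this] show "g * g = g" "S2 g = g" by blast+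
  next
    fix g h assume "g \<in> ?F" "h \<in> ?F" "g \<noteq> h"
    then show "g * h = 0" by (rule 2)
  qed
  moreover have "card ?F = Suc (card F)"
  proof -
    have "card ?F = Suc (Suc (card ?G))" using fin notin by simp
    then show ?thesis by (simp only: card_Suc_Diff1[OF fin f])
  qed
  ultimately show ?thesis by (rule that)
qed

text \<open>
  Orthogonal idempotents are independent, so a decomposition of maximal cardinality exists; it
  cannot be refined.
\<close>

lemma primitive_decomposition:
  obtains F where "orthogonal_decomposition F" "\<And>f. f \<in> F \<Longrightarrow> primitive f"
proof -
  have "1 \<noteq> (0 :: 'h)"
    using linear_form_zero[OF linear_form_counit] counit_one by auto
  then have one: "orthogonal_decomposition {1}"
    by (simp add: orthogonal_decomposition_def S2_one)
  obtain F where F: "orthogonal_decomposition F"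
    and max: "\<And>F'. orthogonal_decomposition F' \<Longrightarrow> card F' \<le> card F"
    using ex_has_greatest_nat[of orthogonal_decomposition "{1}" card "Suc (card Basis)"]
      one card_orthogonal_decomposition by (metis less_Suc_eq_le)
  have "primitive f" if f: "f \<in> F" for f
  proof (rule ccontr)
    assume "\<not> primitive f"
    then obtain e where e: "e * e = e" "S2 e = e" "f * e = e" "e * f = e" "e \<noteq> 0" "e \<noteq> f"
      using F f by (auto simp: primitive_def orthogonal_decomposition_def)
    obtain F' where "orthogonal_decomposition F'" "card F' = Suc (card F)"
      by (rule split_orthogonal_decomposition[OF F f e])
    with max show False by fastforce
  qed
  with F show ?thesis by (rule that)
qed

subsection \<open>Corners of primitive idempotents\<close>

text \<open>
  With a quasi-inverse \<open>z\<close> of \<open>x\<close>, the element \<open>f z x\<close> is a nonzero idempotent of the corner, hence \<open>f\<close>.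
\<close>

lemma corner_left_inverse:
  assumes f: "primitive f" and x: "S2 x = x" "f * x = x" "x * f = x" "x \<noteq> 0"
  obtains y where "y * x = f"
proof -
  obtain z where z: "S2 z = z" "x * z * x = x" by (rule regular_fixed[OF x(1)])
  let ?y = "f * z"
  have "x * (?y * x) = x" using z(2) x(3) by (metis mult.assoc)
  then have ne: "?y * x \<noteq> 0" using x(4) by auto
  have "?y * x * (?y * x) = ?y * (x * (?y * x))" by (simp only: mult.assoc)
  then have "?y * x * (?y * x) = ?y * x" by (simp only: \<open>x * (?y * x) = x\<close>)
  moreover have "S2 (?y * x) = ?y * x"
    by (simp only: S2_mult z(1) x(1) primitiveD(3)[OF f])
  moreover have "f * (?y * x) = ?y * x"
    using primitiveD(2)[OF f] by (metis mult.assoc)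
  moreover have "?y * x * f = ?y * x" by (simp only: mult.assoc x(3))
  ultimately have "?y * x = f" using primitiveD(4)[OF f] ne by blast
  then show ?thesis by (rule that)
qed

text \<open>
  Evaluation of a polynomial at \<open>x\<close> by the Horner scheme. The coefficients are scalars and \<open>x\<close> lives
  in a noncommutative algebra, so \<open>poly\<close> does not apply.
\<close>

definition ev :: "'h \<Rightarrow> 'k poly \<Rightarrow> 'h" where
  "ev x p = fold_coeffs (\<lambda>c v. scale c 1 + x * v) p 0"

lemma ev_pCons: "ev x (pCons c p) = scale c 1 + x * ev x p"
  by (cases "c = 0 \<and> p = 0") (auto simp: ev_def)

lemma ev_0: "ev x 0 = 0"
  by (simp add: ev_def)

lemma ev_add: "ev x (p + q) = ev x p + ev x q"
  by (induction p q rule: poly_induct2) (simp_all add: ev_0 ev_pCons algebra_simps scale_left_distrib)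

lemma ev_smult: "ev x (smult c p) = scale c (ev x p)"
  by (induction p) (simp_all add: ev_0 ev_pCons scale_right_distrib scale_mult_right)

lemma ev_monom: "ev x (monom c n) = scale c (x ^ n)"
  by (induction n) (simp_all add: ev_0 ev_pCons monom_0 monom_Suc scale_mult_right)

lemma ev_sum: "ev x (\<Sum>i\<in>I. p i) = (\<Sum>i\<in>I. ev x (p i))"
  by (induction I rule: infinite_finite_induct) (simp_all add: ev_0 ev_add)

lemma annihilating_polynomial: obtains p where "p \<noteq> 0" "ev x p = 0"
proof (cases "inj_on (\<lambda>i. x ^ i) {..card Basis}")
  case False
  then obtain i j where "i \<noteq> j" "x ^ i = x ^ j" by (auto simp: inj_on_def)
  then have "monom 1 i + monom (-1) j \<noteq> (0 :: 'k poly)" "ev x (monom 1 i + monom (-1) j) = 0"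
    by (auto simp: ev_add ev_monom poly_eq_iff dest!: spec[of _ i])
  then show ?thesis by (rule that)
next
  case True
  let ?X = "(\<lambda>i. x ^ i) ` {..card Basis}"
  have "card ?X = Suc (card Basis)" using True by (simp add: card_image)
  then have "dependent ?X"
    using independent_span_bound[OF finite_Basis, of ?X] by (auto simp: span_Basis)
  then obtain u where u: "\<exists>v\<in>?X. u v \<noteq> 0" "(\<Sum>v\<in>?X. scale (u v) v) = 0"
    using dependent_finite[of ?X] by auto
  define p where "p = (\<Sum>i\<le>card Basis. monom (u (x ^ i)) i)"
  have "ev x p = 0"
    using u(2) by (simp add: p_def ev_sum ev_monom sum.reindex[OF True])
  moreover obtain i where i: "i \<le> card Basis" "u (x ^ i) \<noteq> 0" using u(1) by auto
  have "coeff p i = u (x ^ i)" using i(1) by (simp add: p_def coeff_sum coeff_monom)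
  with i(2) have "p \<noteq> 0" by auto
  ultimately show ?thesis using that by blast
qed

text \<open>
  A finite-dimensional division algebra over an algebraically closed field is trivial: take a root
  \<open>c\<close> of an annihilating polynomial of \<open>x\<close>; unless \<open>x = c f\<close>, the factor \<open>x - c f\<close> is invertible in the
  corner and a polynomial of smaller degree annihilates \<open>x\<close>.
\<close>

lemma corner_fixed_scalar:
  assumes f: "primitive f" and x: "S2 x = x" "f * x = x" "x * f = x"
  obtains c where "x = scale c f"
proof -
  have *: "\<exists>c. x = scale c f" if "p \<noteq> 0" "ev x p * f = 0" for p
    using that
  proof (induction "degree p" arbitrary: p rule: less_induct)
    case less
    show ?case
    proof (cases "degree p = 0")
      case True
      then obtain c where "p = [:c:]" by (rule degree_eq_zeroE)
      with less.prems primitiveD(1)[OF f] show ?thesis by (simp add: ev_pCons ev_0 scale_mult_left)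
    next
      case False
      then obtain z where "poly p z = 0" using alg_closed_imp_poly_has_root by blast
      then obtain q where p: "p = [:- z, 1:] * q" by (auto simp: poly_eq_0_iff_dvd)
      have q: "q \<noteq> 0" using p less.prems(1) by auto
      have deg: "degree q < degree p" using q unfolding p by (subst degree_mult_eq) auto
      let ?t = "x - scale z f"
      have comm: "f * ev x q * f = ev x q * f" for q
      proof (induction q)
        case 0
        show ?case by (simp add: ev_0)
      next
        case (pCons a q)
        have "f * (x * ev x q) * f = x * ev x q * f" using x(2) by (simp flip: mult.assoc)
        then show ?case
          using primitiveD(2)[OF f] by (simp add: ev_pCons distrib_left distrib_right scale_mult_left scale_mult_right)
      qed
      have "p = pCons 0 q + smult (- z) q" by (simp add: p)
      then have "ev x p = x * ev x q - scale z (ev x q)"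
        by (simp only: ev_add ev_pCons ev_smult) simp
      then have "?t * (ev x q * f) = 0"
        using less.prems(2) comm[of q] by (simp add: left_diff_distrib scale_mult_left mult.assoc)
      show ?thesis
      proof (cases "?t = 0")
        case True
        then show ?thesis by auto
      next
        case False
        have "S2 ?t = ?t" "f * ?t = ?t" "?t * f = ?t"
          using x primitiveD(2,3)[OF f]
          by (simp_all add: S2_diff S2_scale left_diff_distrib right_diff_distrib scale_mult_left scale_mult_right)
        then obtain y where y: "y * ?t = f" using corner_left_inverse[OF f _ _ _ False] by blast
        have "f * (ev x q * f) = y * (?t * (ev x q * f))" by (simp only: y flip: mult.assoc)
        then have "ev x q * f = 0"
          using \<open>?t * (ev x q * f) = 0\<close> comm[of q] by (simp add: mult.assoc)
        then show ?thesis by (rule less.hyps[OF deg q])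
      qed
    qed
  qed
  obtain p where "p \<noteq> 0" "ev x p = 0" by (rule annihilating_polynomial)
  with *[of p] that show ?thesis by auto
qed

definition eigenvalue :: "'h \<Rightarrow> 'k" where
  "eigenvalue f = (SOME c. twister * f = scale c f)"

lemma twister_primitive:
  assumes f: "primitive f"
  shows "twister * f = scale (eigenvalue f) f" "f * twister = scale (eigenvalue f) f" "eigenvalue f \<noteq> 0"
proof -
  have comm: "f * twister = twister * f"
    using twister_S2[of f] by (simp add: primitiveD(3)[OF f])
  obtain c where "twister * f = scale c f"
  proof (rule corner_fixed_scalar[OF f, of "twister * f"])
    show "S2 (twister * f) = twister * f"
      by (simp only: S2_mult S2_twister primitiveD(3)[OF f])
    show "f * (twister * f) = twister * f"
      by (metis comm mult.assoc primitiveD(2)[OF f])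
    show "twister * f * f = twister * f"
      by (simp only: mult.assoc primitiveD(2)[OF f])
  qed
  then show 1: "twister * f = scale (eigenvalue f) f"
    unfolding eigenvalue_def by (rule someI)
  then show 2: "f * twister = scale (eigenvalue f) f" by (simp add: comm)
  show "eigenvalue f \<noteq> 0"
    using idempotent_twister_nonzero[OF primitiveD(2)[OF f]] 2 primitiveD(1)[OF f] by auto
qed

text \<open>
  \<open>u\<^sub>f S\<^sup>2 x = w S\<^sup>2 x = x w = u\<^sub>g x\<close>, where \<open>w\<close> is \<open>twister\<close> and \<open>u\<close> its eigenvalues.
\<close>

lemma S2_corner:
  assumes f: "primitive f" and g: "primitive g" and x: "f * x = x" "x * g = x"
  shows "S2 x = scale (eigenvalue g / eigenvalue f) x"
proof -
  have "scale (eigenvalue f) (S2 x) = twister * f * S2 x"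
  proof -
    have "f * S2 x = S2 x" using x(1) S2_mult[of f x] by (simp add: primitiveD(3)[OF f])
    then show ?thesis by (simp add: twister_primitive(1)[OF f] scale_mult_left)
  qed
  also have "\<dots> = twister * S2 (f * x)" by (simp add: S2_mult mult.assoc primitiveD(3)[OF f])
  also have "\<dots> = x * g * twister" by (simp only: x twister_S2[symmetric])
  also have "\<dots> = scale (eigenvalue g) x"
    unfolding mult.assoc twister_primitive(2)[OF g] scale_mult_right by (simp only: x(2))
  finally have "scale (1 / eigenvalue f) (scale (eigenvalue f) (S2 x)) = scale (1 / eigenvalue f) (scale (eigenvalue g) x)"
    by simp
  then show ?thesis using twister_primitive(3)[OF f] by simp
qed

text \<open>
  On the corner at a single \<open>f\<close> the two eigenvalues agree, so all its elements lie in the fixed ring.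
  Thus \<open>f\<close> is primitive in the whole algebra.
\<close>

lemma corner_scalar:
  assumes f: "primitive f" and x: "f * x = x" "x * f = x"
  obtains c where "x = scale c f"
proof (rule corner_fixed_scalar[OF f _ x])
  show "S2 x = x" using S2_corner[OF f f x] twister_primitive(3)[OF f] by simp
qed

lemma corner_inverse:
  assumes f: "primitive f" and g: "primitive g" and x: "f * x = x" "x * g = x" "x \<noteq> 0"
  obtains y where "g * y = y" "y * f = y" "y * x = g"
proof -
  obtain z where z: "x * z * x = x" by (rule regular)
  let ?y = "g * z * f"
  have xy: "x * (?y * x) = x" using z x by (metis mult.assoc)
  have gg: "g * ?y = ?y" "?y * f = ?y"
    using primitiveD(2)[OF f] primitiveD(2)[OF g] by (metis mult.assoc)+
  have "g * (?y * x) = ?y * x" "?y * x * g = ?y * x"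
    using gg(1) x(2) by (metis mult.assoc)+
  then obtain c where c: "?y * x = scale c g" using corner_scalar[OF g] by blast
  have "x = scale c x" using xy by (simp add: c scale_mult_right x(2))
  then have "scale (c - 1) x = 0" by (simp add: scale_left_diff_distrib)
  then have "c = 1" using x(3) by simp
  with gg c show ?thesis using that[of ?y] by simp
qed

text \<open>
  Linked idempotents are those that belong to the same simple block.
\<close>

definition linked :: "'h \<Rightarrow> 'h \<Rightarrow> bool" where
  "linked f g \<longleftrightarrow> (\<exists>h. f * h * g \<noteq> 0)"

lemma linkedE:
  assumes "linked f g" "primitive f" "primitive g"
  obtains x where "f * x = x" "x * g = x" "x \<noteq> 0"
proof -
  obtain h where "f * h * g \<noteq> 0" using assms(1) by (auto simp: linked_def)
  moreover have "f * (f * h * g) = f * h * g" "f * h * g * g = f * h * g"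
    using primitiveD(2)[OF assms(2)] primitiveD(2)[OF assms(3)] by (metis mult.assoc)+
  ultimately show ?thesis using that by blast
qed

lemma linkedI: "f * x = x \<Longrightarrow> x * g = x \<Longrightarrow> x \<noteq> 0 \<Longrightarrow> linked f g"
  unfolding linked_def by (intro exI[of _ x]) simp

lemma linked_refl: "primitive f \<Longrightarrow> linked f f"
  by (rule linkedI[of _ f]) (simp_all add: primitiveD)

lemma linked_sym:
  assumes f: "primitive f" and g: "primitive g" and fg: "linked f g"
  shows "linked g f"
proof -
  obtain x where x: "f * x = x" "x * g = x" "x \<noteq> 0" by (rule linkedE[OF fg f g])
  obtain y where y: "g * y = y" "y * f = y" "y * x = g" by (rule corner_inverse[OF f g x])
  have "y \<noteq> 0" using y(3) primitiveD(1)[OF g] by auto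
  with y show ?thesis by (intro linkedI)
qed

lemma linked_trans:
  assumes f: "primitive f" and g: "primitive g" and h: "primitive h" and "linked f g" "linked g h"
  shows "linked f h"
proof -
  obtain x where x: "f * x = x" "x * g = x" "x \<noteq> 0" by (rule linkedE[OF \<open>linked f g\<close> f g])
  obtain z where z: "g * z = z" "z * h = z" "z \<noteq> 0" by (rule linkedE[OF \<open>linked g h\<close> g h])
  obtain y where y: "y * x = g" using corner_inverse[OF f g x] by blast
  have "y * (x * z) = z" using y z(1) by (simp flip: mult.assoc)
  then have "x * z \<noteq> 0" using z(3) by auto
  moreover have "f * (x * z) = x * z" "x * z * h = x * z" using x(1) z(2) by (metis mult.assoc)+
  ultimately show ?thesis by (intro linkedI)
qed

text \<open>
  If the corner is nonzero, it is spanned by one vector \<open>x\<close>, an eigenvector of \<open>S\<^sup>2\<close>, and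
  \<open>z \<mapsto> f z g\<close> is a rank-one projection onto it.
\<close>

lemma trace_S2_corner:
  assumes f: "primitive f" and g: "primitive g"
  shows "trace (\<lambda>z. S2 (f * z * g)) = (if linked f g then eigenvalue g / eigenvalue f else 0)"
proof (cases "linked f g")
  case False
  then have "f * z * g = 0" for z by (simp add: linked_def)
  then show ?thesis using False
    by (simp add: S2_zero trace_def linear_form_zero[OF linear_form_coord])
next
  case True
  obtain x where x: "f * x = x" "x * g = x" "x \<noteq> 0" by (rule linkedE[OF True f g])
  obtain y where y: "g * y = y" "y * f = y" "y * x = g" by (rule corner_inverse[OF f g x])
  obtain b where b: "coord b x \<noteq> 0"
  proof (rule ccontr)
    assume "\<not> thesis"
    then have "coord b x = 0" for b using that by blast
    then have "(\<Sum>b\<in>Basis. scale (coord b x) b) = 0" by simp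
    with x(3) show False by (simp only: coord_expansion)
  qed
  define \<theta> where "\<theta> z = coord b (f * z * g) * (1 / coord b x)" for z
  have \<theta>: "linear_form \<theta>"
    unfolding \<theta>_def by (intro lin linear_form_compose[OF linear_form_coord])
  have "f * z * g = scale (\<theta> z) x" for z
  proof -
    have "f * (f * z * g * y) = f * z * g * y" "f * z * g * y * f = f * z * g * y"
      using primitiveD(2)[OF f] y(2) by (metis mult.assoc)+
    then obtain d where d: "f * z * g * y = scale d f" using corner_scalar[OF f] by blast
    have "f * z * g = f * z * g * (y * x)" by (simp only: y(3) mult.assoc primitiveD(2)[OF g])
    also have "\<dots> = f * z * g * y * x" by (simp only: mult.assoc)
    also have "\<dots> = scale d x" by (simp only: d scale_mult_left x(1))
    finally show ?thesis
      using b by (simp add: \<theta>_def linear_form_scale[OF linear_form_coord])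
  qed
  then have "trace (\<lambda>z. S2 (f * z * g)) = trace (\<lambda>z. scale (\<theta> z) (S2 x))"
    by (simp only: S2_scale)
  also have "\<dots> = \<theta> (S2 x)" by (rule trace_rank_one[OF \<theta>])
  also have "\<dots> = eigenvalue g / eigenvalue f"
  proof -
    have "\<theta> x = 1" using b x by (simp add: \<theta>_def)
    then show ?thesis
      unfolding S2_corner[OF f g x(1,2)] by (simp add: linear_form_scale[OF \<theta>])
  qed
  finally show ?thesis using True by simp
qed

text \<open>
  The eigenvalues of \<open>twister\<close> are determined only up to a common factor on each block, but ratios
  within a class of linked idempotents are roots of unity because \<open>S\<^sup>2\<close> has finite order. Dividing
  by the eigenvalue of a representative of the class makes the roots of unity lemma applicable.
\<close>

lemma trace_S2_nonzero: "trace S2 \<noteq> 0"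
proof -
  obtain F where F: "orthogonal_decomposition F" and prim: "\<And>f. f \<in> F \<Longrightarrow> primitive f"
    by (rule primitive_decomposition) blast
  have fin: "finite F" and sum: "\<Sum>F = 1" and orth: "\<And>f g. f \<in> F \<Longrightarrow> g \<in> F \<Longrightarrow> f \<noteq> g \<Longrightarrow> f * g = 0"
    using F by (auto simp: orthogonal_decomposition_def)
  have "S2 z = (\<Sum>f\<in>F. \<Sum>g\<in>F. S2 (f * z * g))" for z
  proof -
    have "S2 z = S2 (\<Sum>F * z * \<Sum>F)" by (simp add: sum)
    also have "\<dots> = (\<Sum>g\<in>F. \<Sum>f\<in>F. S2 (f * z * g))"
      by (simp only: sum_distrib_left sum_distrib_right linear_op_sum[OF linear_op_S2])
    finally show ?thesis by (subst sum.swap)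
  qed
  then have "S2 = (\<lambda>z. \<Sum>f\<in>F. \<Sum>g\<in>F. S2 (f * z * g))" by blast
  then have "trace S2 = trace (\<lambda>z. \<Sum>f\<in>F. \<Sum>g\<in>F. S2 (f * z * g))" by (rule arg_cong)
  also have "\<dots> = (\<Sum>f\<in>F. \<Sum>g\<in>F. trace (\<lambda>z. S2 (f * z * g)))"
    by (simp only: trace_sum)
  also have "\<dots> = (\<Sum>f\<in>F. \<Sum>g\<in>F. if linked f g then eigenvalue g / eigenvalue f else 0)"
    by (intro sum.cong refl trace_S2_corner prim)
  finally have tr: "trace S2 = \<dots>" .
  obtain n where n: "n > 0" "\<And>h. (S2 ^^ n) h = h" using S2_finite_order by blast
  have unity: "(eigenvalue g / eigenvalue f) ^ n = 1" if "f \<in> F" "g \<in> F" "linked f g" for f g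
  proof -
    note fg = prim[OF that(1)] prim[OF that(2)] and link = that(3)
    obtain x where x: "f * x = x" "x * g = x" "x \<noteq> 0" by (rule linkedE[OF link fg])
    have "(S2 ^^ k) x = scale ((eigenvalue g / eigenvalue f) ^ k) x" for k
      by (induction k) (simp_all add: S2_scale S2_corner[OF fg x(1,2)] mult.commute)
    from this[of n] have "scale ((eigenvalue g / eigenvalue f) ^ n - 1) x = 0"
      by (simp only: n(2) scale_left_diff_distrib) simp
    then show ?thesis using x(3) by simp
  qed
  define cls where "cls f = {g \<in> F. linked f g}" for f
  have cls: "linked f g \<longleftrightarrow> cls f = cls g" if "f \<in> F" "g \<in> F" for f g
  proof
    assume fg: "linked f g"
    have "linked f h \<longleftrightarrow> linked g h" if "h \<in> F" for h
      using linked_trans[OF prim prim prim fg] linked_trans[OF prim prim prim linked_sym[OF prim prim fg]]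
        \<open>f \<in> F\<close> \<open>g \<in> F\<close> that by blast
    then show "cls f = cls g" unfolding cls_def by blast
  next
    assume "cls f = cls g"
    moreover have "g \<in> cls g" using linked_refl[OF prim] that(2) by (simp add: cls_def)
    ultimately have "g \<in> cls f" by simp
    then show "linked f g" by (simp add: cls_def)
  qed
  (* As rep depends on the class only, linked idempotents are normalised by the same eigenvalue. *)
  define rep where "rep f = (SOME g. g \<in> cls f)" for f
  have rep: "rep f \<in> F" "linked f (rep f)" if "f \<in> F" for f
  proof -
    have "f \<in> cls f" using that prim linked_refl by (simp add: cls_def)
    then have "rep f \<in> cls f" unfolding rep_def by (rule someI)
    then show "rep f \<in> F" "linked f (rep f)" by (auto simp: cls_def)
  qed
  define \<beta> where "\<beta> f = eigenvalue f / eigenvalue (rep f)" for f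
  have \<beta>: "\<beta> f ^ n = 1" if "f \<in> F" for f
    unfolding \<beta>_def using unity[of "rep f" f] rep[OF that] that prim linked_sym by blast
  have ratio: "\<beta> g / \<beta> f = eigenvalue g / eigenvalue f" if "f \<in> F" "g \<in> F" "cls f = cls g" for f g
  proof -
    have "rep f = rep g" using that(3) by (simp add: rep_def)
    then show ?thesis
      using twister_primitive(3)[OF prim[OF rep(1)[OF that(2)]]] by (simp add: \<beta>_def)
  qed
  have "trace S2 = (\<Sum>f\<in>F. \<Sum>g\<in>F. if cls f = cls g then \<beta> g / \<beta> f else 0)"
    unfolding tr by (intro sum.cong refl) (simp add: cls ratio)
  (* The one idempotent of F with nonzero counit absorbs the integral, which must then equal it. *)
  moreover have "\<Lambda> \<in> F"
  proof -
    have "(\<Sum>f\<in>F. \<epsilon> f) \<noteq> 0"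
      by (simp add: counit_one sum flip: linear_form_sum[OF linear_form_counit])
    then obtain f where f: "f \<in> F" "\<epsilon> f \<noteq> 0" using sum.neutral[of F \<epsilon>] by blast
    have "\<epsilon> f * \<epsilon> f = \<epsilon> f" using primitiveD(2)[OF prim[OF f(1)]] counit_mult[of f f] by simp
    then have "\<epsilon> f = 1" using f(2) by simp
    have "\<Lambda> = f"
    proof (rule primitiveD(4)[OF prim[OF f(1)]])
      show "\<Lambda> \<noteq> 0" using counit_\<Lambda> linear_form_zero[OF linear_form_counit] by auto
    qed (simp_all add: mult_\<Lambda> \<Lambda>_mult counit_\<Lambda> S_\<Lambda> \<open>\<epsilon> f = 1\<close>)
    with f(1) show ?thesis by simp
  qed
  moreover have "g = \<Lambda>" if g: "g \<in> F" "cls g = cls \<Lambda>" for g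
  proof -
    have "linked g \<Lambda>" using cls[OF g(1) \<open>\<Lambda> \<in> F\<close>] g(2) by simp
    then obtain h where "g * h * \<Lambda> \<noteq> 0" by (auto simp: linked_def)
    then have "g * \<Lambda> \<noteq> 0" by (auto simp: mult_\<Lambda> counit_mult)
    with orth[OF g(1) \<open>\<Lambda> \<in> F\<close>] show ?thesis by blast
  qed
  ultimately show ?thesis
    using sum_root_of_unity_ratios_nonzero[OF fin n(1), of \<beta> \<Lambda> cls] \<beta> by simp
qed

section \<open>The antipode is an involution\<close>

lemma lam_one_nonzero: "lam 1 \<noteq> 0"
  using trace_S2_nonzero by (simp add: lam_def)

lemma chi_one: "chi 1 = of_nat (card Basis)"
proof -
  have "coord b b = 1" if "b \<in> Basis" for b
    using that by (simp add: coord_def representation_basis independent_Basis)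
  then show ?thesis by (simp add: chi_def trace_def)
qed

lemma chi_S2: "chi (S2 x) = chi x"
proof -
  note l = lin linear_op_inv_S
  have "chi (S2 x) = trace (\<lambda>z. S2 (inv S (inv S z) * x))"
    by (simp add: chi_def S2_mult surj_f_inv_f[OF surj_S])
  also have "\<dots> = trace (\<lambda>z. inv S (inv S (S2 z)) * x)"
    by (rule trace_commute[of "\<lambda>z. S2 z" "\<lambda>z. inv S (inv S z) * x"]) (intro l)+
  also have "\<dots> = chi x"
    by (simp add: chi_def inv_f_f[OF bij_is_inj[OF bij_S]])
  finally show ?thesis .
qed

text \<open>
  Convolution by the regular character, acting on the algebra. Divided by \<open>chi 1 = dim H\<close>, it is an
  idempotent operator.
\<close>

definition chi_act :: "'h \<Rightarrow> 'h" where
  "chi_act h = swv h (\<lambda>a b. scale (chi a) b)"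

lemma linear_form_chi_act: "linear_form \<phi> \<Longrightarrow> \<phi> (chi_act h) = sw h (\<lambda>a b. chi a * \<phi> b)"
  by (simp add: chi_act_def linear_form_swv linear_form_scale)

lemma linear_op_chi_act: "linear_op chi_act"
  unfolding chi_act_def
  by (rule linear_op_swv)
    (simp add: linear_form_scale, intro lin linear_form_chi; simp add: linear_form_def)

lemma chi_act_chi_act: "chi_act (chi_act h) = scale (chi 1) (chi_act h)"
proof (rule linear_forms_separate)
  fix \<phi> assume \<phi>: "linear_form \<phi>"
  note l = lin linear_form_chi linear_form_compose[OF linear_form_chi] \<phi> linear_form_compose[OF \<phi>]
  have "\<phi> (chi_act (chi_act h)) = sw h (\<lambda>a b. chi a * sw b (\<lambda>c d. chi c * \<phi> d))"
    by (simp only: linear_form_chi_act[OF \<phi>]) (rule linear_form_chi_act, intro linear_form_sw l)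
  also have "\<dots> = sw h (\<lambda>a b. sw b (\<lambda>c d. chi a * chi c * \<phi> d))"
    by (simp only: mult.assoc sw_mult_left)
  also have "\<dots> = sw h (\<lambda>u d. sw u (\<lambda>a c. chi a * chi c * \<phi> d))"
    by (rule sw_coassoc[symmetric]) (intro l)+
  also have "\<dots> = sw h (\<lambda>u d. chi 1 * chi u * \<phi> d)"
    by (simp only: sw_mult_right chi_convolution)
  also have "\<dots> = \<phi> (scale (chi 1) (chi_act h))"
    by (simp only: mult.assoc sw_mult_left linear_form_scale[OF \<phi>] linear_form_chi_act[OF \<phi>])
  finally show "\<phi> (chi_act (chi_act h)) = \<phi> (scale (chi 1) (chi_act h))" .
qed

lemma S2_chi_act: "S2 (chi_act h) = chi_act (S2 h)"
proof (rule linear_forms_separate)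
  fix \<phi> assume \<phi>: "linear_form \<phi>"
  note l = lin linear_form_chi linear_form_compose[OF linear_form_chi] \<phi> linear_form_compose[OF \<phi>]
  have "\<phi> (S2 (chi_act h)) = sw h (\<lambda>a b. chi a * \<phi> (S2 b))"
    by (rule linear_form_chi_act) (intro l)
  also have "\<dots> = sw h (\<lambda>a b. chi (S2 a) * \<phi> (S2 b))"
    by (simp only: chi_S2)
  also have "\<dots> = sw (S2 h) (\<lambda>a b. chi a * \<phi> b)"
    by (rule S2_comult[symmetric]) (intro l)
  finally show "\<phi> (S2 (chi_act h)) = \<phi> (chi_act (S2 h))"
    by (simp only: linear_form_chi_act[OF \<phi>])
qed

text \<open>
  In the trace formula, \<open>lam (\<Lambda>\<^sub>3 S (S\<^sup>2 \<Lambda>\<^sub>2)) = lam (S \<Lambda>\<^sub>2 \<Lambda>\<^sub>3)\<close> by the twisted symmetry of \<open>lam\<close>; the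
  antipode cancels and the remaining first leg gives \<open>chi \<Lambda> = 1\<close>.
\<close>

lemma trace_S2_chi_act: "trace (\<lambda>h. S2 (chi_act h)) = lam 1"
proof -
  note l = lin linear_form_chi linear_form_compose[OF linear_form_chi] linear_form_lam linear_form_compose[OF linear_form_lam]
    linear_op_compose[OF linear_op_chi_act]
  have "trace (\<lambda>h. S2 (chi_act h)) = sw \<Lambda> (\<lambda>a b. lam (b * S (S2 (chi_act a))))"
    by (rule trace_eq_sw_\<Lambda>) (intro l)
  also have "\<dots> = sw \<Lambda> (\<lambda>a b. sw a (\<lambda>c d. chi c * lam (S d * b)))"
  proof -
    have "lam (b * S (S2 (chi_act a))) = lam (S (chi_act a) * b)" for a b
      by (simp only: lam_twist[of "S (chi_act a)" b])
    moreover have "lam (S (chi_act a) * b) = sw a (\<lambda>c d. chi c * lam (S d * b))" for a b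
      by (rule linear_form_chi_act) (intro l)
    ultimately show ?thesis by (simp only:)
  qed
  also have "\<dots> = sw \<Lambda> (\<lambda>c b. sw b (\<lambda>d e. chi c * lam (S d * e)))"
    by (rule sw_coassoc) (intro l)+
  also have "\<dots> = sw \<Lambda> (\<lambda>c b. \<epsilon> b * chi c) * lam 1"
    by (simp only: sw_mult_left sw_antipode_left[OF linear_form_lam] sw_mult_right[symmetric])
      (simp add: mult_ac)
  also have "\<dots> = lam 1"
    by (simp add: sw_counit_right linear_form_chi chi_\<Lambda>)
  finally show ?thesis .
qed

text \<open>
  \<open>P (\<plusminus>1)\<close> are the projections onto the eigenspaces of the involution \<open>S\<^sup>2\<close>, of ranks \<open>p\<close> and \<open>q\<close>, and
  \<open>r\<close>, \<open>s\<close> are the ranks of their products with the idempotent \<open>E\<close>. Then \<open>p + q = d\<close> and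
  \<open>p - q = Tr S\<^sup>2 = d (r - s) \<noteq> 0\<close>, so one of \<open>p\<close>, \<open>q\<close> vanishes; \<open>S\<^sup>2 1 = 1\<close> excludes \<open>p = 0\<close>.
\<close>

theorem antipode_involutive: "S (S h) = h"
proof -
  note inv = S2_involutive[OF lam_one_nonzero]
  let ?d = "card Basis"
  have d: "?d > 0"
  proof (rule ccontr)
    assume "\<not> ?thesis"
    then have empty: "Basis = {}" using finite_Basis by auto
    have "trace S2 = 0" unfolding trace_def by (rule sum.neutral) (simp add: empty)
    with trace_S2_nonzero show False by simp
  qed
  have two: "(1 / 2 + 1 / 2 :: 'k) = 1" by simp
  have half: "scale (1 / 2) x + scale (1 / 2) x = x" for x
    by (simp only: two scale_one flip: scale_left_distrib)
  define P where "P c x = scale (1 / 2) (x + scale c (S2 x))" for c x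
  have P_lin: "linear_op (P c)" for c
    by (rule linear_opI)
      (simp_all add: P_def S2_add S2_scale scale_right_distrib algebra_simps)
  have P_idem: "P c (P c x) = P c x" if "c * c = 1" for c x
  proof -
    have "P c (P c x) = scale (1 / 2) (scale (1 / 2) (x + scale c (S2 x)) + scale (1 / 2) (scale c (S2 x) + scale (c * c) x))"
      by (simp only: P_def S2_add S2_scale inv scale_right_distrib scale_scale mult_ac)
    also have "\<dots> = scale (1 / 2) (x + scale c (S2 x))"
      by (simp only: that scale_one add.commute[of _ x] half)
    finally show ?thesis by (simp only: P_def)
  qed
  have P_trace: "trace (P 1) + trace (P (-1)) = of_nat ?d" "trace (P 1) - trace (P (-1)) = lam 1"
  proof -
    have P_tr: "trace (P c) = 1 / 2 * (of_nat ?d + c * lam 1)" for c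
    proof -
      have "trace (P c) = 1 / 2 * (trace (\<lambda>x. x) + c * trace S2)"
        unfolding P_def by (simp only: trace_scale trace_add)
      then show ?thesis using chi_one by (simp add: chi_def lam_def)
    qed
    show "trace (P 1) + trace (P (-1)) = of_nat ?d" "trace (P 1) - trace (P (-1)) = lam 1"
      unfolding P_tr by (simp_all add: field_simps)
  qed
  obtain p where p: "trace (P 1) = of_nat p" "p = 0 \<Longrightarrow> P 1 = (\<lambda>x. 0)"
    by (rule trace_idempotent[OF P_lin P_idem, of 1]) simp_all
  obtain q where q: "trace (P (-1)) = of_nat q" "q = 0 \<Longrightarrow> P (-1) = (\<lambda>x. 0)"
    by (rule trace_idempotent[OF P_lin P_idem, of "-1"]) simp_all
  define E where "E x = scale (1 / of_nat ?d) (chi_act x)" for x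
  have E_lin: "linear_op E"
    unfolding E_def
    by (rule linear_opI) (simp_all add: linear_op_add[OF linear_op_chi_act] linear_op_scale[OF linear_op_chi_act] scale_right_distrib)
  have E_idem: "E (E x) = E x" for x
    using d by (simp add: E_def linear_op_scale[OF linear_op_chi_act] chi_act_chi_act chi_one)
  have E_S2: "E (S2 x) = S2 (E x)" for x
    by (simp add: E_def S2_chi_act S2_scale)
  have PE: "P c (E x) = E (P c x)" for c x
    by (simp add: P_def linear_op_scale[OF E_lin] linear_op_add[OF E_lin] E_S2)
  have PE_idem: "P c (E (P c (E x))) = P c (E x)" if "c * c = 1" for c x
    by (simp only: PE[symmetric] P_idem[OF that] E_idem)
  have PE_trace: "of_nat ?d * (trace (\<lambda>x. P 1 (E x)) - trace (\<lambda>x. P (-1) (E x))) = lam 1"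
  proof -
    have "trace (\<lambda>x. P 1 (E x)) - trace (\<lambda>x. P (-1) (E x)) = trace (\<lambda>x. P 1 (E x) - P (-1) (E x))"
      by (rule trace_diff[symmetric])
    also have "\<dots> = trace (\<lambda>x. S2 (E x))"
    proof -
      have "P 1 x - P (-1) x = S2 x" for x
        using half[of "S2 x"] by (simp add: P_def scale_right_distrib scale_right_diff_distrib)
      then show ?thesis by (simp only:)
    qed
    also have "\<dots> = 1 / of_nat ?d * lam 1"
      by (simp only: E_def S2_scale trace_scale trace_S2_chi_act)
    finally show ?thesis using d by simp
  qed
  obtain r where r: "trace (\<lambda>x. P 1 (E x)) = of_nat r"
    by (rule trace_idempotent[OF linear_op_compose[OF P_lin E_lin] PE_idem, of 1]) simp_all
  obtain s where s: "trace (\<lambda>x. P (-1) (E x)) = of_nat s"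
    by (rule trace_idempotent[OF linear_op_compose[OF P_lin E_lin] PE_idem, of "-1"]) simp_all
  have sum: "p + q = ?d"
    using P_trace(1) unfolding p(1) q(1) by (simp flip: of_nat_add)
  have "of_int (int p - int q) = (of_int (int ?d * (int r - int s)) :: 'k)"
    using P_trace(2) PE_trace unfolding p(1) q(1) r s by simp
  then have eq: "int p - int q = int ?d * (int r - int s)" by (simp only: of_int_eq_iff)
  have "lam 1 = of_int (int p - int q)" using P_trace(2) by (simp add: p(1) q(1))
  then have "int p - int q \<noteq> 0" using lam_one_nonzero by auto
  then have "int r - int s \<noteq> 0" using eq by auto
  then have "\<bar>int r - int s\<bar> \<ge> 1" by linarith
  then have "int ?d * 1 \<le> int ?d * \<bar>int r - int s\<bar>" by (rule mult_left_mono) simp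
  also have "\<dots> = \<bar>int p - int q\<bar>" by (simp add: eq abs_mult)
  finally have "p = 0 \<or> q = 0" using sum by linarith
  moreover have "p \<noteq> 0"
  proof
    assume "p = 0"
    then have "P 1 1 = 0" using p(2) by simp
    moreover have "P 1 1 = 1" by (simp only: P_def S2_one scale_one scale_right_distrib half)
    ultimately have "(1 :: 'h) = 0" by simp
    then show False using linear_form_zero[OF linear_form_counit] counit_one by simp
  qed
  ultimately have "P (-1) h = 0" using q(2) by simp
  then show ?thesis by (simp add: P_def)
qed

section \<open>The Casimir element and the recursion for \<open>z\<close>\<close>

text \<open>
  The words over the terms of \<open>\<Delta> \<Lambda>\<close> that index \<open>hopf_z\<close>, with the three factors of the summand of a
  word. Splitting off the first letter of a word gives the recursion \<open>sum_words_Suc\<close>.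
\<close>

definition words :: "nat \<Rightarrow> ('h \<times> 'h) list set" where
  "words n = {w. length w = n \<and> set w \<subseteq> Poly_Mapping.keys (tensor_rep (\<Delta> \<Lambda>))}"

definition weight :: "('h \<times> 'h) list \<Rightarrow> 'k" where
  "weight w = prod_list (map (Poly_Mapping.lookup (tensor_rep (\<Delta> \<Lambda>))) w)"

definition left_word :: "('h \<times> 'h) list \<Rightarrow> 'h" where "left_word w = prod_list (map fst w)"
definition right_word :: "('h \<times> 'h) list \<Rightarrow> 'h" where "right_word w = prod_list (map (\<lambda>t. S (snd t)) w)"

abbreviation z :: "nat \<Rightarrow> 'h" where "z \<equiv> hopf_z scale \<Delta> S \<Lambda>"

lemma z_eq: "z n = (\<Sum>w\<in>words n. scale (weight w) (left_word w * right_word w))"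
  by (simp add: hopf_z_def Let_def words_def weight_def left_word_def right_word_def)

lemma swv_eq_sum: "swv \<Lambda> f = (\<Sum>t\<in>Poly_Mapping.keys (tensor_rep (\<Delta> \<Lambda>)).
    scale (Poly_Mapping.lookup (tensor_rep (\<Delta> \<Lambda>)) t) (f (fst t) (snd t)))"
  by (simp add: swv_def sweedler_def lin_extend_def case_prod_beta)

text \<open>
  The recursion is stated for an arbitrary \<open>f\<close> in place of multiplication since a second letter has
  to be split off inside the two factors left by the first one.
\<close>

lemma sum_words_Suc:
  "(\<Sum>w\<in>words (Suc n). scale (weight w) (f (left_word w) (right_word w))) =
   swv \<Lambda> (\<lambda>a b. \<Sum>w\<in>words n. scale (weight w) (f (a * left_word w) (S b * right_word w)))"
proof -
  let ?K = "Poly_Mapping.keys (tensor_rep (\<Delta> \<Lambda>))"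
  have "words (Suc n) = (\<lambda>(t, w). t # w) ` (?K \<times> words n)"
    by (auto simp: words_def length_Suc_conv image_iff)
  then have "(\<Sum>w\<in>words (Suc n). scale (weight w) (f (left_word w) (right_word w))) =
      (\<Sum>(t, w)\<in>?K \<times> words n. scale (weight (t # w)) (f (left_word (t # w)) (right_word (t # w))))"
    by (simp add: sum.reindex inj_on_def case_prod_beta)
  also have "\<dots> = (\<Sum>t\<in>?K. \<Sum>w\<in>words n. scale (weight (t # w)) (f (left_word (t # w)) (right_word (t # w))))"
    by (rule sum.cartesian_product[symmetric])
  also have "\<dots> = swv \<Lambda> (\<lambda>a b. \<Sum>w\<in>words n. scale (weight w) (f (a * left_word w) (S b * right_word w)))"
    by (simp add: swv_eq_sum weight_def left_word_def right_word_def scale_sum_right)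
  finally show ?thesis .
qed

text \<open>
  From here on, \<open>\<Lambda>\<^sub>1 \<otimes> S \<Lambda>\<^sub>2\<close> is handled as one symmetric element of \<open>H \<otimes> H\<close>; the involutivity of \<open>S\<close>
  is what turns \<open>S \<Lambda>\<^sub>2 \<otimes> S (S \<Lambda>\<^sub>1)\<close> into its flip.
\<close>

lemma casimir_flip: "bilinear_form f \<Longrightarrow> sw \<Lambda> (\<lambda>a b. f (S b) a) = sw \<Lambda> (\<lambda>a b. f a (S b))"
  using \<Lambda>_flip[of "\<lambda>a b. f a (S b)"]
  by (simp add: antipode_involutive bilinear_form_def linear_form_compose linear_op_S)

lemma casimir_outer:
  assumes f: "bilinear_form f"
  shows "sw \<Lambda> (\<lambda>a b. f (x * a) (S b)) = sw \<Lambda> (\<lambda>a b. f a (S b * x))"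
proof -
  note l = lin linear_form_compose[OF bilinear_formD(1)[OF f]] linear_form_compose[OF bilinear_formD(2)[OF f]]
  have "sw \<Lambda> (\<lambda>a b. f (S (S x) * a) (S b)) = sw \<Lambda> (\<lambda>a b. f a (S (S x * b)))"
    by (rule \<Lambda>_move_left) (intro l)
  then show ?thesis by (simp add: antipode_involutive antipode_mult)
qed

lemma casimir_product: "swv \<Lambda> (\<lambda>a b. a * S b) = 1"
  using antipode_right[of \<Lambda>] by (simp add: swv_def counit_\<Lambda>)

text \<open>
  In a matrix block of size \<open>d\<close> this is the scalar \<open>1 / d\<^sup>2\<close>. The order of the factors is the one that
  arises in the proofs below; \<open>z_two\<close> identifies it with the second \<open>z\<close>.
\<close>

definition z2 :: 'h where
  "z2 = swv \<Lambda> (\<lambda>a b. swv \<Lambda> (\<lambda>c d. c * a * S d * S b))"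

lemma linear_form_z2: "linear_form \<phi> \<Longrightarrow> \<phi> z2 = sw \<Lambda> (\<lambda>a b. sw \<Lambda> (\<lambda>c d. \<phi> (c * a * S d * S b)))"
  by (simp add: z2_def linear_form_swv)

text \<open>
  With \<open>p\<close>, \<open>q\<close> the second legs: \<open>\<Sum> a c x p q = \<Sum> c x p q a = \<Sum> c x a q p = \<Sum> c a q p x\<close>, by an outer
  move of \<open>a\<close> along the second copy, a flip of the first copy, and an outer move of \<open>x\<close> along the
  first copy.
\<close>

lemma casimir_double_right:
  assumes \<phi>: "linear_form \<phi>"
  shows "sw \<Lambda> (\<lambda>a b. sw \<Lambda> (\<lambda>c d. \<phi> (a * c * x * S b * S d))) = \<phi> (z2 * x)"
proof -
  note l = lin linear_form_compose[OF \<phi>]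
  have "sw \<Lambda> (\<lambda>a b. sw \<Lambda> (\<lambda>c d. \<phi> (a * c * x * S b * S d))) =
      sw \<Lambda> (\<lambda>a b. sw \<Lambda> (\<lambda>c d. \<phi> (c * x * S b * (S d * a))))"
    using casimir_outer[of "\<lambda>c d. \<phi> (c * x * S b * d)" a for a b] by (simp add: l mult.assoc)
  also have "\<dots> = sw \<Lambda> (\<lambda>a b. sw \<Lambda> (\<lambda>c d. \<phi> (c * x * a * (S d * S b))))"
    by (rule casimir_flip[of "\<lambda>a b. sw \<Lambda> (\<lambda>c d. \<phi> (c * x * a * (S d * b)))"]) (intro l)
  also have "\<dots> = sw \<Lambda> (\<lambda>a b. sw \<Lambda> (\<lambda>c d. \<phi> (c * a * (S d * (S b * x)))))"
    using casimir_outer[of "\<lambda>a b. sw \<Lambda> (\<lambda>c d. \<phi> (c * a * (S d * b)))" x] by (simp add: l mult.assoc)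
  also have "\<dots> = \<phi> (z2 * x)"
    by (subst linear_form_z2[of "\<lambda>z. \<phi> (z * x)"]) (intro l, simp add: mult.assoc)
  finally show ?thesis .
qed

text \<open>
  The mirror image: \<open>\<Sum> a c x p q = \<Sum> q a c x p = \<Sum> c a q x p = \<Sum> x c a q p\<close>.
\<close>

lemma casimir_double_left:
  assumes \<phi>: "linear_form \<phi>"
  shows "sw \<Lambda> (\<lambda>a b. sw \<Lambda> (\<lambda>c d. \<phi> (a * c * x * S b * S d))) = \<phi> (x * z2)"
proof -
  note l = lin linear_form_compose[OF \<phi>]
  have "sw \<Lambda> (\<lambda>a b. sw \<Lambda> (\<lambda>c d. \<phi> (a * c * x * S b * S d))) =
      sw \<Lambda> (\<lambda>c d. sw \<Lambda> (\<lambda>a b. \<phi> (a * (c * x) * (S b * S d))))"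
    by (subst sw_swap) (simp add: mult.assoc)
  also have "\<dots> = sw \<Lambda> (\<lambda>c d. sw \<Lambda> (\<lambda>a b. \<phi> (S d * a * (c * x) * S b)))"
    using casimir_outer[of "\<lambda>a b. \<phi> (a * (c * x) * b)" "S d" for c d] by (simp add: l mult.assoc)
  also have "\<dots> = sw \<Lambda> (\<lambda>c d. sw \<Lambda> (\<lambda>a b. \<phi> (c * a * (S d * x) * S b)))"
    by (rule casimir_flip[of "\<lambda>c d. sw \<Lambda> (\<lambda>a b. \<phi> (c * a * (d * x) * S b))"]) (intro l)
  also have "\<dots> = sw \<Lambda> (\<lambda>c d. sw \<Lambda> (\<lambda>a b. \<phi> (x * (c * a * S d * S b))))"
    using casimir_outer[of "\<lambda>c d. sw \<Lambda> (\<lambda>a b. \<phi> (c * a * (d * S b)))" x] by (simp add: l mult.assoc)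
  also have "\<dots> = \<phi> (x * z2)"
    by (subst sw_swap, rule linear_form_z2[of "\<lambda>z. \<phi> (x * z)", symmetric]) (intro l)
  finally show ?thesis .
qed

lemma z2_commute: "z2 * x = x * z2"
  by (rule linear_forms_separate) (simp flip: casimir_double_left casimir_double_right)

lemma z_Suc_Suc: "z (Suc (Suc n)) = z2 * z n"
proof (rule linear_forms_separate)
  fix \<phi> assume \<phi>: "linear_form \<phi>"
  have "z (Suc (Suc n)) = swv \<Lambda> (\<lambda>a b. \<Sum>w\<in>words (Suc n). scale (weight w) (a * left_word w * (S b * right_word w)))"
    unfolding z_eq by (rule sum_words_Suc[of "(*)"])
  also have "\<dots> = swv \<Lambda> (\<lambda>a b. swv \<Lambda> (\<lambda>c d. \<Sum>w\<in>words n.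
      scale (weight w) (a * (c * left_word w) * (S b * (S d * right_word w)))))"
    by (simp only: sum_words_Suc[of "\<lambda>l r. a * l * (S b * r)" for a b])
  finally have "\<phi> (z (Suc (Suc n))) = (\<Sum>w\<in>words n. weight w *
      sw \<Lambda> (\<lambda>a b. sw \<Lambda> (\<lambda>c d. \<phi> (a * c * left_word w * S b * S d * right_word w))))"
    by (simp add: linear_form_swv \<phi> linear_form_sum linear_form_scale sw_sum sw_mult_left mult.assoc)
  also have "\<dots> = (\<Sum>w\<in>words n. weight w * \<phi> (z2 * left_word w * right_word w))"
  proof (rule sum.cong[OF refl], rule arg_cong[where f = "\<lambda>t. c * t" for c])
    fix w
    show "sw \<Lambda> (\<lambda>a b. sw \<Lambda> (\<lambda>c d. \<phi> (a * c * left_word w * S b * S d * right_word w))) =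
        \<phi> (z2 * left_word w * right_word w)"
      by (rule casimir_double_right[of "\<lambda>v. \<phi> (v * right_word w)"]) (intro lin linear_form_compose[OF \<phi>])
  qed
  also have "\<dots> = \<phi> (z2 * z n)"
    by (simp add: z_eq sum_distrib_left linear_form_sum[OF \<phi>] linear_form_scale[OF \<phi>] scale_mult_right mult.assoc)
  finally show "\<phi> (z (Suc (Suc n))) = \<phi> (z2 * z n)" .
qed

lemma z_even: "z (2 * m) = z2 ^ m"
  and z_odd: "z (2 * m + 1) = z2 ^ m"
proof (induction m)
  case 0
  show "z (2 * 0) = z2 ^ 0" "z (2 * 0 + 1) = z2 ^ 0"
    using casimir_product by (simp_all add: hopf_z_0 hopf_z_1 swv_def)
next
  case (Suc m)
  have "2 * Suc m = Suc (Suc (2 * m))" "2 * Suc m + 1 = Suc (Suc (2 * m + 1))" by simp_all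
  then show "z (2 * Suc m) = z2 ^ Suc m" "z (2 * Suc m + 1) = z2 ^ Suc m"
    by (simp_all only: z_Suc_Suc Suc power_Suc)
qed

lemma z_two: "z 2 = z2"
  using z_even[of 1] by simp

lemma z_eq_power: "z n = z 2 ^ (n div 2)"
proof (cases "even n")
  case True
  then show ?thesis using z_even[of "n div 2"] by (simp add: z_two)
next
  case False
  then show ?thesis using z_odd[of "n div 2"] by (simp add: z_two)
qed

lemma z_two_power_central: "z 2 ^ k \<in> ring_center"
  using power_commuting_commutes[OF z2_commute] by (simp add: ring_center_def z_two)

end

theorem theorem2p7:
  fixes scale :: "'k::{alg_closed_field, field_char_0} \<Rightarrow> 'h::ring_1 \<Rightarrow> 'h"
    and \<Delta> :: "'h \<Rightarrow> ('h \<times> 'h \<Rightarrow>\<^sub>0 'k) set"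
    and \<epsilon> :: "'h \<Rightarrow> 'k"
    and S :: "'h \<Rightarrow> 'h"
    and \<Lambda> :: 'h
    and m n :: nat
  assumes "hopf_algebra scale \<Delta> \<epsilon> S"
    and "\<exists>B. finite_dimensional_vector_space scale B"
    and "semisimple_ring TYPE('h)"
    and "idempotent_integral scale \<epsilon> \<Lambda>"
  shows "hopf_z scale \<Delta> S \<Lambda> (2 * m + 1) = hopf_z scale \<Delta> S \<Lambda> (2 * m) \<and>
    hopf_z scale \<Delta> S \<Lambda> n = hopf_z scale \<Delta> S \<Lambda> 2 ^ ((n - n mod 2) div 2) \<and>
    hopf_z scale \<Delta> S \<Lambda> 2 ^ ((n - n mod 2) div 2) \<in> ring_center"
proof -
  obtain B where B: "finite_dimensional_vector_space scale B" using assms(2) by blast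
  interpret semisimple_hopf_algebra scale \<Delta> \<epsilon> S B \<Lambda>
    by (intro semisimple_hopf_algebra.intro finite_dim_hopf_integral.intro finite_dim_hopf_algebra.intro
        finite_dim_hopf_integral_axioms.intro semisimple_hopf_algebra_axioms.intro assms B)
  have "(n - n mod 2) div 2 = n div 2" by (simp add: minus_mod_eq_mult_div)
  then show ?thesis
    using z_even[of m] z_odd[of m] z_eq_power[of n] z_two_power_central by simp
qed

end
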